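(* Let $\varepsilon\in(0,1)$. Let $P$ be the transition law of a Markov chain on $\mathbb Z^d$ with uniformly bounded jumps, let $c$ be a cost function and $\alpha\in(0,1)$ a discount factor, such that the primitives $\mu,\sigma^2,c$ satisfy the Primitives Assumption (stated in the context). Let $\widetilde P=PGU$ be the sister chain obtained from a coarse grid scheme with a zero-mean construction of $(G,U)$, and suppose that its maximal jumps satisfy $$\widetilde\Delta_x\lesssim 1+(1-\alpha)^{1/4}\|x\|^{\frac{1-\varepsilon}{2}}.$$ Then, for any $\kappa\ge 2+\varepsilon-\frac k2$ and all $x$ with $\|x\|\ge(1-\alpha)^{-(1+\kappa)}$, $$|\widetilde V(x)-V(x)|\lesssim\frac{1}{\sqrt{1-\alpha}}\Big(V_{-1}(x)+\widetilde V_{-1}(x)+V_{-\varepsilon}(x)+\widetilde V_{-\varepsilon}(x)\Big),$$ where the constant implicit in $\lesssim$ does not depend on $x$ or $\alpha$.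
   Context: Setting. $P=(p_{xy})$ is a transition law on $\mathbb Z^d$; $V(x)=\mathbb E_x[\sum_{t\ge0}\alpha^tc(X_t)]$ is its value, and $\widetilde V(x)=\widetilde{\mathbb E}_x[\sum_{t\ge0}\alpha^tc(X_t)]$ the value under the sister chain $\widetilde P$ (same $c$ and $\alpha$). Local moments: $\mu(x)=\mathbb E_x[X_1-x]$, $\sigma^2(x)=\mathbb E_x[(X_1-x)(X_1-x)^\intercal]$. Maximal jumps: $\Delta_x=\sup\{\|y-x\|:p_{xy}>0\}$ and $\widetilde\Delta_x=\sup\{\|y-x\|:\widetilde p_{xy}>0\}$; $\|\cdot\|$ is the Euclidean norm. The focal chain $P$ has bounded jumps: $\sup_x\Delta_x<\infty$. For $\varepsilon\in(0,1]$, $$V_{-\varepsilon}(x)=\mathbb E_x\Big[\sum_{t=0}^\infty\alpha^t\frac{|c(X_t)|}{(1+\|X_t\|)^\varepsilon}\Big],$$ $V_{-1}$ is this with exponent $1$, and $\widetilde V_{-\varepsilon},\widetilde V_{-1}$ are defined in the same way with $\widetilde{\mathbb E}_x$ (the law of $\widetilde P$). Sister chain. There is a set of meta-states $\mathcal M$, each $l\in\mathcal M$ having its own representative state $x_l\in\mathbb Z^d$; $U=(u_{lx})$ is given by $u_{lx_l}=1$ and $u_{lx}=0$ for $x\neq x_l$; $G=(g_{yl})$ is non-negative and row-stochastic with $\sum_lg_{yl}x_l=y$ for every $y$ (zero-mean construction); $\widetilde P=PGU$. In particular $\widetilde P$ and $P$ have the same first local moment $\mu$, while their second local moments may differ. Norm-like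 cost: there is $k\in\mathbb Z_+$ such that $\frac1\Gamma\|x\|^k\le|c(x)|\le\Gamma(1+\|x\|)^k$, with $c\ge0$. The $k$ in the claim and below is this $k$. Primitives Assumption. $\mu,\sigma^2,c$ have extensions to $\mathbb R^d$ (denoted by the same letters) such that, with $\mathcal B_r=\{x\in\mathbb R^d:\|x\|<r\}$, $|f|^*_{\mathcal B}=\sup_{x\in\mathcal B}\|f(x)\|$, $[f]_{\mathcal B}=\sup_{x\neq y\in\mathcal B}\frac{\|f(y)-f(x)\|}{\|y-x\|}$, and for all $r>0$: 1. $\mu$ is globally bounded and Lipschitz and $(1-\alpha)^{-1/2}|\mu|^*_{\mathcal B_r}+(1-\alpha)^{-1}[\mu]_{\mathcal B_r}\le\Gamma$; 2. $\sigma^2$ is globally bounded and Lipschitz with $|\sigma^2|^*_{\mathcal B_r}+(1-\alpha)^{-1/2}[\sigma^2]_{\mathcal B_r}\le\Gamma$, and there exists $\lambda>0$ such that $\lambda^{-1}\|\xi\|^2\ge\sum_{i,j}\xi_i\xi_j(\sigma^2(x))_{ij}\ge\lambda\|\xi\|^2$ for all $\xi,x\in\mathbb R^d$; 3. $c$ is norm-like and three times differentiable with $|D^ic|^*_{\mathcal B_r}\le\Gamma(1+r^{k-i})$ for $i=0,1,2$. Convention. $\Gamma$ denotes a constant that does not depend on the state $x$ or on $\alpha$, and $f(x)\lesssim q(x)$ means $f(x)\le\Gamma q(x)$ for such a constant. The implicit constant in the conclusion is thus uniform in $x$ and over all discount factors and chains satisfying the hypotheses with the same constants; it may depend on $d,k,\varepsilon,\kappa,\lambda$,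 on the constants in the hypotheses, and on the bound for the jumps of $P$. *)

theory Defs
  imports "HOL-Probability.Probability"
begin

subsection \<open>Path law of a time-homogeneous Markov chain\<close>

text \<open>A transition law is a family of \<open>pmf\<close>s, \<open>p x y = pmf (K x) y\<close>. The law of the whole
  trajectory started in \<open>x\<close> is the Ionescu-Tulcea limit of the coordinate kernels below.\<close>

definition chain_kernel :: "('s \<Rightarrow> 's pmf) \<Rightarrow> 's \<Rightarrow> nat \<Rightarrow> (nat \<Rightarrow> 's) \<Rightarrow> 's measure" where
  "chain_kernel K x n \<omega> =
     measure_pmf (case n of 0 \<Rightarrow> return_pmf x | Suc m \<Rightarrow> K (\<omega> m))"

definition chain_law :: "('s \<Rightarrow> 's pmf) \<Rightarrow> 's \<Rightarrow> (nat \<Rightarrow> 's) measure" where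
  "chain_law K x =
     projective_family.lim UNIV
       (Ionescu_Tulcea.CI (chain_kernel K x) (\<lambda>_. count_space UNIV)) (\<lambda>_. count_space UNIV)"

lemma Ionescu_Tulcea_chain_kernel:
  "Ionescu_Tulcea (chain_kernel K x) (\<lambda>_. count_space UNIV)"
proof (rule Ionescu_Tulcea.intro)
  fix i
  show "chain_kernel K x i \<in>
      measurable (PiM {0..<i} (\<lambda>_. count_space UNIV)) (subprob_algebra (count_space UNIV))"
  proof (cases i)
    case 0
    have "measure_pmf (return_pmf x) \<in> space (subprob_algebra (count_space UNIV))"
      by (simp add: measure_pmf_in_subprob_algebra)
    then show ?thesis
      by (simp add: 0 chain_kernel_def[abs_def])
  next
    case (Suc m)
    have "(\<lambda>\<omega>. \<omega> m) \<in> measurable (PiM {0..<i} (\<lambda>_. count_space UNIV)) (count_space UNIV)"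
      by (rule measurable_component_singleton) (simp add: Suc)
    moreover have "(\<lambda>s. measure_pmf (K s)) \<in>
        measurable (count_space UNIV) (subprob_algebra (count_space UNIV))"
      by (simp add: measure_pmf_in_subprob_algebra)
    ultimately show ?thesis
      unfolding chain_kernel_def[abs_def] Suc nat.case by (rule measurable_compose)
  qed
next
  fix i \<omega>
  show "prob_space (chain_kernel K x i \<omega>)"
    unfolding chain_kernel_def by (rule prob_space_measure_pmf)
qed

text \<open>The law has the Markov finite-dimensional distributions.\<close>

lemma emeasure_chain_law_cylinder:
  "emeasure (chain_law K x) {\<omega>. \<forall>i\<le>n. \<omega> i = s i} =
     ennreal (indicator {x} (s 0) * (\<Prod>i<n. pmf (K (s i)) (s (Suc i))))"
proof -
  let ?M = "\<lambda>_::nat. count_space (UNIV :: 'a set)"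
  interpret IT: Ionescu_Tulcea "chain_kernel K x" ?M
    by (rule Ionescu_Tulcea_chain_kernel)
  define X where "X m = PiE {0..<m} (\<lambda>i. {s i})" for m :: nat
  have X_sets[measurable]: "X m \<in> sets (PiM {0..<m} ?M)" for m
    unfolding X_def by (rule sets_PiM_I_finite) auto
  have eP: "emeasure (IT.eP m \<omega>) (X (Suc m)) =
      indicator (X m) \<omega> * emeasure (chain_kernel K x m s) {s m}"
    if \<omega>: "\<omega> \<in> space (PiM {0..<m} ?M)" for m \<omega>
  proof -
    have "fun_upd \<omega> m a \<in> X (Suc m) \<longleftrightarrow> \<omega> \<in> X m \<and> a = s m" for a
    proof -
      have "(\<forall>i<Suc m. fun_upd \<omega> m a i = s i) \<longleftrightarrow> (\<forall>i<m. \<omega> i = s i) \<and> a = s m"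
        by (simp only: All_less_Suc) auto
      moreover have "\<omega> \<in> extensional {0..<m}" "fun_upd \<omega> m a \<in> extensional {0..<Suc m}"
        using \<omega> by (auto simp: space_PiM PiE_def extensional_def)
      ultimately show ?thesis
        by (auto simp: X_def PiE_iff)
    qed
    then have "(\<lambda>a. fun_upd \<omega> m a) -` X (Suc m) \<inter> space (?M m) = (if \<omega> \<in> X m then {s m} else {})"
      by auto
    moreover have "chain_kernel K x m \<omega> = chain_kernel K x m s" if "\<omega> \<in> X m"
      using that by (auto simp: chain_kernel_def X_def PiE_iff split: nat.split)
    ultimately show ?thesis
      using IT.emeasure_eP[OF \<omega> X_sets] by (auto simp: indicator_def)
  qed
  have C: "emeasure (IT.C 0 m (\<lambda>_. undefined)) (X m) =
      (\<Prod>i<m. emeasure (chain_kernel K x i s) {s i})" for m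
  proof (induction m)
    case 0
    have "(\<lambda>_. undefined) \<in> X 0"
      by (simp add: X_def)
    then show ?case
      using X_sets[of 0] by (simp add: emeasure_return)
  next
    case (Suc m)
    have u: "(\<lambda>_. undefined) \<in> space (PiM {0..<0} ?M)"
      by (simp add: space_PiM)
    have sp: "space (IT.C 0 m (\<lambda>_. undefined)) = space (PiM {0..<m} ?M)"
      using IT.space_C[OF u] by simp
    have st: "sets (IT.C 0 m (\<lambda>_. undefined)) = sets (PiM {0..<m} ?M)"
      using IT.sets_C[OF u] by simp
    have "emeasure (IT.C 0 (Suc m) (\<lambda>_. undefined)) (X (Suc m)) =
        (\<integral>\<^sup>+\<omega>. emeasure (IT.eP m \<omega>) (X (Suc m)) \<partial>IT.C 0 m (\<lambda>_. undefined))"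
      unfolding IT.C.simps add_0
      by (rule emeasure_bind[where N="PiM {0..<Suc m} ?M"])
         (use sp IT.measurable_eP[of m] in \<open>auto simp: measurable_cong_sets[OF st refl]\<close>)
    also have "\<dots> = (\<integral>\<^sup>+\<omega>. emeasure (chain_kernel K x m s) {s m} * indicator (X m) \<omega>
        \<partial>IT.C 0 m (\<lambda>_. undefined))"
      by (intro nn_integral_cong) (simp add: sp eP mult.commute)
    also have "\<dots> = emeasure (chain_kernel K x m s) {s m} *
        emeasure (IT.C 0 m (\<lambda>_. undefined)) (X m)"
      by (rule nn_integral_cmult_indicator) (simp add: st)
    finally show ?case
      by (simp add: Suc mult.commute)
  qed
  have emb: "{\<omega>. \<forall>i\<le>n. \<omega> i = s i} = prod_emb UNIV ?M {0..<Suc n} (X (Suc n))"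
    by (auto simp: prod_emb_def X_def PiE_iff less_Suc_eq_le space_PiM)
  have "emeasure (chain_law K x) {\<omega>. \<forall>i\<le>n. \<omega> i = s i} = emeasure (IT.CI {0..<Suc n}) (X (Suc n))"
    unfolding chain_law_def emb by (rule IT.lim) auto
  also have "\<dots> = emeasure (IT.C 0 (Suc n) (\<lambda>_. undefined))
      (prod_emb {0..<Suc n} ?M {0..<Suc n} (X (Suc n)))"
    by (rule IT.emeasure_CI) auto
  also have "prod_emb {0..<Suc n} ?M {0..<Suc n} (X (Suc n)) = X (Suc n)"
    by (rule prod_emb_id) (auto simp: X_def PiE_def)
  also have "emeasure (IT.C 0 (Suc n) (\<lambda>_. undefined)) (X (Suc n)) =
      (\<Prod>i<Suc n. emeasure (chain_kernel K x i s) {s i})"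
    by (rule C)
  also have "\<dots> = ennreal (indicator {x} (s 0)) * (\<Prod>i<n. ennreal (pmf (K (s i)) (s (Suc i))))"
    by (subst prod.lessThan_Suc_shift)
       (auto simp: chain_kernel_def emeasure_pmf_single indicator_def)
  also have "\<dots> = ennreal (indicator {x} (s 0) * (\<Prod>i<n. pmf (K (s i)) (s (Suc i))))"
    by (simp add: prod_ennreal prod_nonneg ennreal_mult)
  finally show ?thesis .
qed

subsection \<open>Chains on the integer lattice\<close>

definition lat :: "int ^ 'd \<Rightarrow> real ^ 'd" where
  "lat x = (\<chi> i. real_of_int (x $ i))"

text \<open>For nonnegative costs of polynomial growth and jumps of sublinear growth, the random
  variable below is integrable, so its Bochner integral is the expectation.\<close>

definition discounted_value ::
    "(int ^ 'd \<Rightarrow> (int ^ 'd) pmf) \<Rightarrow> real \<Rightarrow> (int ^ 'd \<Rightarrow> real) \<Rightarrow> int ^ 'd \<Rightarrow> real" where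
  "discounted_value K \<alpha> c x = (LINT \<omega>|chain_law K x. (\<Sum>t. \<alpha> ^ t * c (\<omega> t)))"

definition weighted_value ::
    "(int ^ 'd \<Rightarrow> (int ^ 'd) pmf) \<Rightarrow> real \<Rightarrow> (int ^ 'd \<Rightarrow> real) \<Rightarrow> real \<Rightarrow> int ^ 'd \<Rightarrow> real" where
  "weighted_value K \<alpha> c \<epsilon> x =
     (LINT \<omega>|chain_law K x. (\<Sum>t. \<alpha> ^ t * (\<bar>c (\<omega> t)\<bar> / (1 + norm (lat (\<omega> t))) powr \<epsilon>)))"

definition local_mean :: "(int ^ 'd \<Rightarrow> (int ^ 'd) pmf) \<Rightarrow> int ^ 'd \<Rightarrow> real ^ 'd" where
  "local_mean K x = (LINT \<omega>|chain_law K x. lat (\<omega> 1) - lat x)"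

definition local_second :: "(int ^ 'd \<Rightarrow> (int ^ 'd) pmf) \<Rightarrow> int ^ 'd \<Rightarrow> real ^ 'd ^ 'd" where
  "local_second K x =
     (LINT \<omega>|chain_law K x.
        (\<chi> i j. (lat (\<omega> 1) - lat x) $ i * (lat (\<omega> 1) - lat x) $ j))"

definition max_jump :: "(int ^ 'd \<Rightarrow> (int ^ 'd) pmf) \<Rightarrow> int ^ 'd \<Rightarrow> ereal" where
  "max_jump K x = (SUP y\<in>{y. pmf (K x) y > 0}. ereal (norm (lat y - lat x)))"

subsection \<open>Sister chains\<close>

text \<open>\<open>M\<close> is the set of meta-states and \<open>rep l\<close> the representative state of \<open>l\<close>.
  The rows of the stochastic matrices \<open>G\<close> and \<open>U\<close> are \<open>pmf\<close>s, and the matrix product of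
  stochastic matrices is the monadic composition of kernels.\<close>

definition zero_mean_construction ::
    "'m set \<Rightarrow> ('m \<Rightarrow> int ^ 'd) \<Rightarrow> (int ^ 'd \<Rightarrow> 'm pmf) \<Rightarrow> bool" where
  "zero_mean_construction M rep G \<longleftrightarrow>
     inj_on rep M \<and>
     (\<forall>y. set_pmf (G y) \<subseteq> M \<and> ((\<lambda>l. pmf (G y) l *\<^sub>R lat (rep l)) has_sum lat y) M)"

definition U_matrix :: "('m \<Rightarrow> int ^ 'd) \<Rightarrow> 'm \<Rightarrow> (int ^ 'd) pmf" where
  "U_matrix rep l = return_pmf (rep l)"

definition sister_chain ::
    "(int ^ 'd \<Rightarrow> (int ^ 'd) pmf) \<Rightarrow> (int ^ 'd \<Rightarrow> 'm pmf) \<Rightarrow> ('m \<Rightarrow> int ^ 'd) \<Rightarrow>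
     int ^ 'd \<Rightarrow> (int ^ 'd) pmf" where
  "sister_chain P G rep x =
     bind_pmf (P x) (\<lambda>y. bind_pmf (G y) (\<lambda>l. U_matrix rep l))"

subsection \<open>Assumptions on the primitives\<close>

text \<open>Norms on vectors and matrices are the Euclidean (Frobenius) norms. The suprema are taken
  in the extended reals, so that a bound on them entails their finiteness.\<close>

definition sup_norm :: "(real ^ 'd \<Rightarrow> 'b::real_normed_vector) \<Rightarrow> real \<Rightarrow> ereal" where
  "sup_norm f r = (SUP x\<in>ball 0 r. ereal (norm (f x)))"

definition lip_seminorm :: "(real ^ 'd \<Rightarrow> 'b::real_normed_vector) \<Rightarrow> real \<Rightarrow> ereal" where
  "lip_seminorm f r =
     (SUP (x, y)\<in>{(x, y). x \<in> ball 0 r \<and> y \<in> ball 0 r \<and> x \<noteq> y}.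
        ereal (norm (f y - f x) / norm (y - x)))"

definition bounded_Lipschitz :: "(real ^ 'd \<Rightarrow> 'b::real_normed_vector) \<Rightarrow> bool" where
  "bounded_Lipschitz f \<longleftrightarrow> bounded (range f) \<and> (\<exists>L. L-lipschitz_on UNIV f)"

definition norm_like :: "nat \<Rightarrow> real \<Rightarrow> (real ^ 'd \<Rightarrow> real) \<Rightarrow> bool" where
  "norm_like k \<Gamma> c \<longleftrightarrow>
     (\<forall>x. 0 \<le> c x \<and> 1 / \<Gamma> * norm x ^ k \<le> \<bar>c x\<bar> \<and> \<bar>c x\<bar> \<le> \<Gamma> * (1 + norm x) ^ k)"

text \<open>\<open>Dc\<close> and \<open>D2c\<close> are the gradient and the Hessian of \<open>c\<close>; differentiability of the Hessian
  gives the third derivative. The exponents \<open>k - i\<close> may be negative, hence \<open>powi\<close>.\<close>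

definition smooth_cost :: "nat \<Rightarrow> real \<Rightarrow> (real ^ 'd \<Rightarrow> real) \<Rightarrow> bool" where
  "smooth_cost k \<Gamma> c \<longleftrightarrow>
     (\<exists>(Dc :: real ^ 'd \<Rightarrow> real ^ 'd) (D2c :: real ^ 'd \<Rightarrow> real ^ 'd ^ 'd).
        (\<forall>x. (c has_derivative (\<lambda>h. Dc x \<bullet> h)) (at x)) \<and>
        (\<forall>x. (Dc has_derivative (\<lambda>h. D2c x *v h)) (at x)) \<and>
        (\<forall>x. D2c differentiable (at x)) \<and>
        (\<forall>r>0. sup_norm c r \<le> ereal (\<Gamma> * (1 + r powi int k)) \<and>
               sup_norm Dc r \<le> ereal (\<Gamma> * (1 + r powi (int k - 1))) \<and>
               sup_norm D2c r \<le> ereal (\<Gamma> * (1 + r powi (int k - 2)))))"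

definition primitives_assumption ::
    "nat \<Rightarrow> real \<Rightarrow> real \<Rightarrow> real \<Rightarrow> (int ^ 'd \<Rightarrow> (int ^ 'd) pmf) \<Rightarrow> (int ^ 'd \<Rightarrow> real) \<Rightarrow> bool" where
  "primitives_assumption k \<Gamma> lam \<alpha> P c \<longleftrightarrow>
     (\<exists>(\<mu> :: real ^ 'd \<Rightarrow> real ^ 'd) (\<sigma>2 :: real ^ 'd \<Rightarrow> real ^ 'd ^ 'd) (c' :: real ^ 'd \<Rightarrow> real).
        (\<forall>x. \<mu> (lat x) = local_mean P x) \<and>
        (\<forall>x. \<sigma>2 (lat x) = local_second P x) \<and>
        (\<forall>x. c' (lat x) = c x) \<and>
        bounded_Lipschitz \<mu> \<and>
        (\<forall>r>0. ereal ((1 - \<alpha>) powr (-1/2)) * sup_norm \<mu> r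
             + ereal ((1 - \<alpha>) powr (-1)) * lip_seminorm \<mu> r \<le> ereal \<Gamma>) \<and>
        bounded_Lipschitz \<sigma>2 \<and>
        (\<forall>r>0. sup_norm \<sigma>2 r
             + ereal ((1 - \<alpha>) powr (-1/2)) * lip_seminorm \<sigma>2 r \<le> ereal \<Gamma>) \<and>
        (\<forall>x \<xi>. inverse lam * (norm \<xi>)\<^sup>2 \<ge> (\<Sum>i\<in>UNIV. \<Sum>j\<in>UNIV. \<xi> $ i * \<xi> $ j * \<sigma>2 x $ i $ j) \<and>
               (\<Sum>i\<in>UNIV. \<Sum>j\<in>UNIV. \<xi> $ i * \<xi> $ j * \<sigma>2 x $ i $ j) \<ge> lam * (norm \<xi>)\<^sup>2) \<and>
        norm_like k \<Gamma> c' \<and>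
        smooth_cost k \<Gamma> c')"

end

theory Submission
  imports Defs
begin

text \<open>Let \<open>s = 1 / sqrt (1 - \<alpha>)\<close>, so that the horizon is \<open>s^2\<close>, and compare both values with
  the frozen value \<open>s^2 * c x\<close>. By Dynkin's formula for the resolvent, \<open>V x - s^2 * c x\<close> is at
  most \<open>s^2\<close> times the discounted sum of \<open>\<bar>P c - c\<bar>\<close>. Both chains have the same drift, of size
  \<open>1 / s\<close>, and squared jumps of size \<open>1 + \<parallel>y\<parallel>^(1 - \<epsilon>) / s\<close>. Write \<open>u = 1 + \<parallel>y\<parallel>\<close>.
  For \<open>k \<ge> 2\<close> a second order expansion bounds \<open>\<bar>P c - c\<bar>\<close> up to constants by
  \<open>u^(k - 1) / s + u^(k - 2) \<le> 2 * u^(k - 1) / s + s^(k - 2)\<close>; the first summand produces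
  \<open>s * V\<^sub>-\<^sub>1\<close> and the second one \<open>s^(k + 2)\<close>. For \<open>k = 1\<close> the Lipschitz cost is compared with
  \<open>c x\<close> through the mean square displacement, which costs \<open>s^3\<close> and \<open>V\<^sub>-\<^sub>\<epsilon>\<close>. It remains to absorb
  \<open>s^(k + 2)\<close> into \<open>s * V\<^sub>-\<^sub>1\<close> for the focal chain: if \<open>k \<ge> 3\<close>, ellipticity drives the chain to
  distance \<open>s\<close> from the origin within the horizon, and if \<open>k \<le> 2\<close> the chain starts at distance
  at least \<open>s^4\<close> and stays far away by Chebyshev's inequality.\<close>

subsection \<open>One-dimensional marginals of the path law\<close>

lemma sets_chain_law [measurable_cong]:
  "sets (chain_law K x) = sets (PiM UNIV (\<lambda>_. count_space UNIV))"
proof -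
  interpret IT: Ionescu_Tulcea "chain_kernel K x" "\<lambda>_. count_space UNIV"
    by (rule Ionescu_Tulcea_chain_kernel)
  show ?thesis
    unfolding chain_law_def by (rule IT.PF.sets_lim)
qed

lemma space_chain_law [simp]: "space (chain_law K x) = UNIV"
  using sets_eq_imp_space_eq[OF sets_chain_law[of K x]] by (simp add: space_PiM)

lemma measurable_chain_coord [measurable]:
  "(\<lambda>\<omega>. \<omega> n) \<in> measurable (chain_law K x) (count_space UNIV)"
  unfolding measurable_cong_sets[OF sets_chain_law refl] by measurable

text \<open>The law of the state at time \<open>n\<close>, by Chapman-Kolmogorov. It is identified
  below with the marginal of \<open>chain_law\<close>, so that expectations can be computed on
  discrete laws instead of path space.\<close>

primrec chain_pmf :: "('s \<Rightarrow> 's pmf) \<Rightarrow> 's \<Rightarrow> nat \<Rightarrow> 's pmf" where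
  "chain_pmf K x 0 = return_pmf x"
| "chain_pmf K x (Suc n) = chain_pmf K x n \<bind> K"

text \<open>Partition both events by the states before time \<open>n\<close>: each piece is a
  cylinder of known mass, and appending \<open>b\<close> multiplies all these masses by the same
  factor. Countability of the state space makes the partition countable.\<close>

lemma emeasure_chain_law_Suc:
  fixes K :: "'s::countable \<Rightarrow> 's pmf"
  shows "emeasure (chain_law K x) {\<omega>. \<omega> n = a \<and> \<omega> (Suc n) = b} =
    emeasure (chain_law K x) {\<omega>. \<omega> n = a} * ennreal (pmf (K a) b)"
proof -
  \<comment> \<open>A list in \<open>L\<close> records the states at the times before
    \<open>n\<close>; \<open>C l\<close> continues it by \<open>a\<close> at time \<open>n\<close>,
    and \<open>C' l\<close> also by \<open>b\<close> at time \<open>Suc n\<close>.\<close>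
  define L where "L = {l :: 's list. length l = n}"
  define C where "C l = {\<omega>. \<forall>i\<le>n. \<omega> i = (l @ [a]) ! i}" for l
  define C' where "C' l = {\<omega>. \<forall>i\<le>Suc n. \<omega> i = (l @ [a, b]) ! i}" for l
  let ?p = "\<lambda>l. indicator {x} ((l @ [a]) ! 0) *
    (\<Prod>i<n. pmf (K ((l @ [a]) ! i)) ((l @ [a]) ! Suc i))"
  have C_iff: "\<omega> \<in> C l \<longleftrightarrow> l = map \<omega> [0..<n] \<and> \<omega> n = a" if "l \<in> L" for l \<omega>
  proof
    assume "\<omega> \<in> C l"
    then have *: "\<omega> i = (l @ [a]) ! i" if "i \<le> n" for i
      using that by (simp add: C_def)
    have "l ! i = map \<omega> [0..<n] ! i" if "i < n" for i
      using *[of i] that \<open>l \<in> L\<close> by (simp add: nth_append L_def)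
    moreover have "\<omega> n = a"
      using *[of n] \<open>l \<in> L\<close> by (simp add: nth_append L_def)
    ultimately show "l = map \<omega> [0..<n] \<and> \<omega> n = a"
      using \<open>l \<in> L\<close> by (simp add: L_def list_eq_iff_nth_eq)
  next
    assume "l = map \<omega> [0..<n] \<and> \<omega> n = a"
    then show "\<omega> \<in> C l"
      by (simp add: C_def nth_append)
  qed
  have ext: "(l @ [a, b]) ! i = (if i \<le> n then (l @ [a]) ! i else b)"
    if "l \<in> L" "i \<le> Suc n" for l i
    using that by (auto simp: nth_append nth_Cons L_def split: nat.split)
  have C': "C' l = C l \<inter> {\<omega>. \<omega> (Suc n) = b}" if "l \<in> L" for l
    using that by (simp add: C_def C'_def ext le_Suc_eq set_eq_iff) (metis Suc_n_not_le_n)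
  have mapL: "map \<omega> [0..<n] \<in> L" for \<omega> :: "nat \<Rightarrow> 's"
    by (simp add: L_def)
  have U: "{\<omega>. \<omega> n = a} = (\<Union>l\<in>L. C l)"
    using mapL by (simp add: set_eq_iff C_iff)
  have U': "{\<omega>. \<omega> n = a \<and> \<omega> (Suc n) = b} = (\<Union>l\<in>L. C' l)"
  proof -
    have "(\<Union>l\<in>L. C' l) = (\<Union>l\<in>L. C l) \<inter> {\<omega>. \<omega> (Suc n) = b}"
      by (simp add: C')
    also have "\<dots> = {\<omega>. \<omega> n = a} \<inter> {\<omega>. \<omega> (Suc n) = b}"
      by (simp only: U)
    finally show ?thesis
      by (simp add: Collect_conj_eq)
  qed
  have disj: "disjoint_family_on C L"
    by (auto simp: disjoint_family_on_def C_iff)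
  have disj': "disjoint_family_on C' L"
    using disj by (auto simp: disjoint_family_on_def C' C_iff)
  have m: "{\<omega>. \<forall>i\<le>m. \<omega> i = s i} \<in> sets (chain_law K x)" for m s
  proof -
    have "Measurable.pred (chain_law K x) (\<lambda>\<omega>. \<forall>i\<in>{..m}. \<omega> i = s i)"
      by measurable
    then show ?thesis
      by (simp add: pred_def Ball_def)
  qed
  have mC: "C l \<in> sets (chain_law K x)" "C' l \<in> sets (chain_law K x)" for l
    unfolding C_def C'_def by (rule m)+
  have e: "emeasure (chain_law K x) (C l) = ennreal (?p l)" for l
    unfolding C_def by (rule emeasure_chain_law_cylinder)
  have e': "emeasure (chain_law K x) (C' l) = ennreal (?p l) * ennreal (pmf (K a) b)"
    if "l \<in> L" for l
  proof -
    have "emeasure (chain_law K x) (C' l) = ennreal (indicator {x} ((l @ [a, b]) ! 0) *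
        (\<Prod>i<Suc n. pmf (K ((l @ [a, b]) ! i)) ((l @ [a, b]) ! Suc i)))"
      unfolding C'_def by (rule emeasure_chain_law_cylinder)
    also have "indicator {x} ((l @ [a, b]) ! 0) *
        (\<Prod>i<Suc n. pmf (K ((l @ [a, b]) ! i)) ((l @ [a, b]) ! Suc i)) = ?p l * pmf (K a) b"
    proof -
      have "(l @ [a]) ! n = a"
        using that by (simp add: L_def nth_append)
      then show ?thesis
        using that by (simp add: ext)
    qed
    also have "ennreal (?p l * pmf (K a) b) = ennreal (?p l) * ennreal (pmf (K a) b)"
      by (intro ennreal_mult) (auto intro!: mult_nonneg_nonneg prod_nonneg)
    finally show ?thesis .
  qed
  have "emeasure (chain_law K x) {\<omega>. \<omega> n = a \<and> \<omega> (Suc n) = b} =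
      (\<integral>\<^sup>+l. emeasure (chain_law K x) (C' l) \<partial>count_space L)"
    unfolding U' using mC disj' by (intro emeasure_UN_countable) auto
  also have "\<dots> = (\<integral>\<^sup>+l. emeasure (chain_law K x) (C l) * ennreal (pmf (K a) b) \<partial>count_space L)"
    using e e' by (intro nn_integral_cong) auto
  also have "\<dots> = (\<integral>\<^sup>+l. emeasure (chain_law K x) (C l) \<partial>count_space L) * ennreal (pmf (K a) b)"
    by (rule nn_integral_multc) auto
  also have "(\<integral>\<^sup>+l. emeasure (chain_law K x) (C l) \<partial>count_space L) =
      emeasure (chain_law K x) {\<omega>. \<omega> n = a}"
    unfolding U using mC disj by (intro emeasure_UN_countable[symmetric]) auto
  finally show ?thesis .
qed

text \<open>Sum the one-step identity over the state at time \<open>n\<close>; the result is the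
  bind that defines \<open>chain_pmf\<close>.\<close>

lemma emeasure_chain_law_coord:
  fixes K :: "'s::countable \<Rightarrow> 's pmf"
  shows "emeasure (chain_law K x) {\<omega>. \<omega> n = a} = ennreal (pmf (chain_pmf K x n) a)"
proof (induction n arbitrary: a)
  case 0
  have "{\<omega> :: nat \<Rightarrow> 's. \<omega> 0 = a} = {\<omega>. \<forall>i\<le>0. \<omega> i = a}"
    by auto
  then show ?case
    using emeasure_chain_law_cylinder[of K x 0 "\<lambda>_. a"] by (simp add: indicator_def)
next
  case (Suc n)
  let ?A = "\<lambda>b. {\<omega>. \<omega> n = b \<and> \<omega> (Suc n) = a}"
  have U: "{\<omega>. \<omega> (Suc n) = a} = (\<Union>b. ?A b)"
    by auto
  have m: "?A b \<in> sets (chain_law K x)" for b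
  proof -
    have "Measurable.pred (chain_law K x) (\<lambda>\<omega>. \<omega> n = b \<and> \<omega> (Suc n) = a)"
      by measurable
    then show ?thesis
      by (simp add: pred_def)
  qed
  have "emeasure (chain_law K x) {\<omega>. \<omega> (Suc n) = a} =
      (\<integral>\<^sup>+b. emeasure (chain_law K x) (?A b) \<partial>count_space UNIV)"
    unfolding U using m by (intro emeasure_UN_countable) (auto simp: disjoint_family_on_def)
  also have "\<dots> = (\<integral>\<^sup>+b. ennreal (pmf (chain_pmf K x n) b) * ennreal (pmf (K b) a) \<partial>count_space UNIV)"
    by (simp add: emeasure_chain_law_Suc Suc)
  also have "\<dots> = ennreal (pmf (chain_pmf K x (Suc n)) a)"
    by (simp add: ennreal_pmf_bind nn_integral_measure_pmf)
  finally show ?case .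
qed

lemma distr_chain_law_coord:
  fixes K :: "'s::countable \<Rightarrow> 's pmf"
  shows "distr (chain_law K x) (count_space UNIV) (\<lambda>\<omega>. \<omega> n) = measure_pmf (chain_pmf K x n)"
proof (rule measure_eqI_countable[where A = UNIV])
  fix a :: 's
  have "(\<lambda>\<omega>. \<omega> n) -` {a} \<inter> space (chain_law K x) = {\<omega>. \<omega> n = a}"
    by auto
  then show "emeasure (distr (chain_law K x) (count_space UNIV) (\<lambda>\<omega>. \<omega> n)) {a} =
      emeasure (measure_pmf (chain_pmf K x n)) {a}"
    by (simp add: emeasure_distr emeasure_chain_law_coord emeasure_pmf_single)
qed auto

lemma integral_chain_law_coord:
  fixes K :: "'s::countable \<Rightarrow> 's pmf" and f :: "'s \<Rightarrow> 'b::{banach, second_countable_topology}"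
  shows "(LINT \<omega>|chain_law K x. f (\<omega> n)) = measure_pmf.expectation (chain_pmf K x n) f"
  unfolding distr_chain_law_coord[symmetric]
  by (rule integral_distr[symmetric]) auto

lemma integrable_chain_law_coord:
  fixes K :: "'s::countable \<Rightarrow> 's pmf" and f :: "'s \<Rightarrow> 'b::{banach, second_countable_topology}"
  assumes "integrable (measure_pmf (chain_pmf K x n)) f"
  shows "integrable (chain_law K x) (\<lambda>\<omega>. f (\<omega> n))"
  using assms unfolding distr_chain_law_coord[symmetric]
  by (subst (asm) integrable_distr_eq) auto

lemma AE_chain_law_coord:
  fixes K :: "'s::countable \<Rightarrow> 's pmf"
  assumes "\<And>y. y \<in> set_pmf (chain_pmf K x n) \<Longrightarrow> Q y"
  shows "AE \<omega> in chain_law K x. Q (\<omega> n)"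
proof -
  have "AE y in distr (chain_law K x) (count_space UNIV) (\<lambda>\<omega>. \<omega> n). Q y"
    unfolding distr_chain_law_coord using assms by (simp add: AE_measure_pmf_iff)
  then show ?thesis
    by (subst (asm) AE_distr_iff) auto
qed

subsection \<open>Functions of polynomial growth on the lattice\<close>

text \<open>The coordinates of such points are integers between fixed bounds. Chains whose jumps
  from each state are bounded thus have finitely supported transition laws, on which every function
  is integrable.\<close>

lemma finite_lat_ball: "finite {y :: int ^ 'd. norm (lat y) \<le> R}"
proof -
  let ?N = "\<lceil>R\<rceil>"
  have "y \<in> vec_lambda ` (PiE UNIV (\<lambda>_. {-?N..?N}))" if "norm (lat y) \<le> R" for y :: "int ^ 'd"
  proof -
    have "y $ i \<in> {-?N..?N}" for i
    proof -
      have "\<bar>real_of_int (y $ i)\<bar> \<le> R"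
        using component_le_norm_cart[of "lat y" i] that by (simp add: lat_def)
      then show ?thesis
        by simp linarith
    qed
    then have "vec_nth y \<in> PiE UNIV (\<lambda>_. {-?N..?N})"
      by auto
    then show ?thesis
      by (metis image_eqI vec_nth_inverse)
  qed
  moreover have "finite (vec_lambda ` (PiE (UNIV :: 'd set) (\<lambda>_. {-?N..?N})))"
    by (intro finite_imageI finite_PiE) auto
  ultimately show ?thesis
    by (auto intro: finite_subset)
qed

lemma lat_0 [simp]: "lat 0 = 0"
  by (simp add: lat_def vec_eq_iff)

text \<open>A class closed under the algebraic operations and, for the chains below, under one-step
  expectations, on which every discounted sum converges absolutely. The sign condition on
  \<open>A\<close> allows bounds to be multiplied.\<close>

definition poly_growth :: "(int ^ 'd \<Rightarrow> real) \<Rightarrow> bool" where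
  "poly_growth f \<longleftrightarrow> (\<exists>A m. 0 \<le> A \<and> (\<forall>y. \<bar>f y\<bar> \<le> A * (1 + norm (lat y)) ^ m))"

lemma poly_growthI:
  fixes f :: "int ^ 'd \<Rightarrow> real"
  assumes "\<And>y. \<bar>f y\<bar> \<le> A * (1 + norm (lat y)) ^ m"
  shows "poly_growth f"
proof -
  \<comment> \<open>At the origin the weight is 1, so the assumed bound itself forces
    \<open>A\<close> to be nonnegative.\<close>
  have "0 \<le> A * (1 + norm (lat (0 :: int ^ 'd))) ^ m"
    using assms[of 0] by (meson abs_ge_zero order_trans)
  then have "0 \<le> A"
    by (simp add: zero_le_mult_iff)
  then show ?thesis
    using assms unfolding poly_growth_def by blast
qed

lemma poly_growth_mono:
  assumes "poly_growth g" "\<And>y. \<bar>f y\<bar> \<le> g y"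
  shows "poly_growth f"
proof -
  obtain A m where "0 \<le> A" "\<bar>g y\<bar> \<le> A * (1 + norm (lat y)) ^ m" for y
    using assms(1) unfolding poly_growth_def by blast
  then have "\<bar>f y\<bar> \<le> A * (1 + norm (lat y)) ^ m" for y
    using assms(2)[of y] by (meson abs_ge_self order_trans)
  then show ?thesis
    by (rule poly_growthI)
qed

lemma poly_growth_const: "poly_growth (\<lambda>_. a)"
  by (rule poly_growthI[of _ "\<bar>a\<bar>" 0]) simp

lemma poly_growth_norm: "poly_growth (\<lambda>y. norm (lat y))"
  by (rule poly_growthI[of _ 1 1]) simp

lemma poly_growth_mult:
  assumes "poly_growth f" "poly_growth g"
  shows "poly_growth (\<lambda>y. f y * g y)"
proof -
  obtain A m B n where "0 \<le> A" "0 \<le> B" and *: "\<bar>f y\<bar> \<le> A * (1 + norm (lat y)) ^ m"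
      "\<bar>g y\<bar> \<le> B * (1 + norm (lat y)) ^ n" for y
    using assms unfolding poly_growth_def by blast
  have "\<bar>f y * g y\<bar> \<le> (A * B) * (1 + norm (lat y)) ^ (m + n)" for y
    using mult_mono[OF *(1)[of y] *(2)[of y]] \<open>0 \<le> A\<close> by (simp add: abs_mult power_add mult_ac)
  then show ?thesis
    by (rule poly_growthI)
qed

lemma poly_growth_add:
  assumes "poly_growth f" "poly_growth g"
  shows "poly_growth (\<lambda>y. f y + g y)"
proof -
  obtain A m B n where AB: "0 \<le> A" "0 \<le> B" and *: "\<bar>f y\<bar> \<le> A * (1 + norm (lat y)) ^ m"
      "\<bar>g y\<bar> \<le> B * (1 + norm (lat y)) ^ n" for y
    using assms unfolding poly_growth_def by blast
  have "\<bar>f y + g y\<bar> \<le> (A + B) * (1 + norm (lat y)) ^ (m + n)" for y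
  proof -
    have "A * (1 + norm (lat y)) ^ m \<le> A * (1 + norm (lat y)) ^ (m + n)"
      "B * (1 + norm (lat y)) ^ n \<le> B * (1 + norm (lat y)) ^ (m + n)"
      using AB by (auto intro!: mult_left_mono power_increasing)
    then show ?thesis
      using *[of y] by (simp add: distrib_right)
  qed
  then show ?thesis
    by (rule poly_growthI)
qed

lemma poly_growth_power: "poly_growth f \<Longrightarrow> poly_growth (\<lambda>y. f y ^ n)"
  by (induction n) (auto intro: poly_growth_const poly_growth_mult)

lemma poly_growth_minus: "poly_growth f \<Longrightarrow> poly_growth (\<lambda>y. - f y)"
  using poly_growth_mult[OF poly_growth_const[of "-1"], of f] by simp

lemma poly_growth_diff:
  "poly_growth f \<Longrightarrow> poly_growth g \<Longrightarrow> poly_growth (\<lambda>y. f y - g y)"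
  using poly_growth_add[OF _ poly_growth_minus, of f g] by simp

lemma poly_growth_divide: "poly_growth f \<Longrightarrow> poly_growth (\<lambda>y. f y / a)"
  using poly_growth_mult[OF _ poly_growth_const[of "inverse a"], of f] by (simp add: divide_inverse)

text \<open>Some coordinate is a nonzero integer. This later allows \<open>1 + norm (lat y)\<close>
  to be replaced by \<open>2 * norm (lat y)\<close> away from the origin.\<close>

lemma one_le_norm_lat:
  assumes "y \<noteq> 0"
  shows "1 \<le> norm (lat y)"
proof -
  obtain i where "y $ i \<noteq> 0"
    using assms by (auto simp: vec_eq_iff)
  then have "1 \<le> \<bar>lat y $ i\<bar>"
    by (simp add: lat_def)
  then show ?thesis
    using component_le_norm_cart[of "lat y" i] by linarith
qed

lemma poly_growth_weighted:
  assumes "poly_growth f" "0 \<le> p"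
  shows "poly_growth (\<lambda>y. \<bar>f y\<bar> / (1 + norm (lat y)) powr p)"
proof -
  obtain A m where A: "0 \<le> A" "\<bar>f y\<bar> \<le> A * (1 + norm (lat y)) ^ m" for y
    using assms unfolding poly_growth_def by blast
  have "\<bar>\<bar>f y\<bar> / (1 + norm (lat y)) powr p\<bar> \<le> A * (1 + norm (lat y)) ^ m" for y
  proof -
    have "\<bar>f y\<bar> / (1 + norm (lat y)) powr p \<le> \<bar>f y\<bar> / 1"
      using assms(2) by (intro divide_left_mono) (auto intro!: ge_one_powr_ge_zero simp: add_nonneg_eq_0_iff)
    then show ?thesis
      using A(2)[of y] by simp
  qed
  then show ?thesis
    by (rule poly_growthI)
qed

lemma poly_growth_norm_powr:
  assumes "p \<le> 1"
  shows "poly_growth (\<lambda>y. norm (lat y) powr p)"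
proof (rule poly_growth_mono)
  show "poly_growth (\<lambda>y. 1 + norm (lat y))"
    by (intro poly_growth_add poly_growth_const poly_growth_norm)
  fix y :: "int ^ 'd"
  show "\<bar>norm (lat y) powr p\<bar> \<le> 1 + norm (lat y)"
  proof (cases "y = 0")
    \<comment> \<open>Here \<open>0 powr p = 0\<close> for every \<open>p\<close>, also for a
      negative one.\<close>
    case True
    then show ?thesis
      by simp
  next
    case False
    have "1 \<le> norm (lat y)"
      using False by (rule one_le_norm_lat)
    then have "norm (lat y) powr p \<le> norm (lat y) powr 1"
      using assms by (intro powr_mono) auto
    then show ?thesis
      by simp
  qed
qed

lemmas poly_growth_intros =
  poly_growth_const poly_growth_norm poly_growth_mult poly_growth_add poly_growth_power
  poly_growth_minus poly_growth_diff poly_growth_divide poly_growth_norm_powr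

text \<open>Ratio test: consecutive terms have a ratio tending to \<alpha>, which is eventually
  below the midpoint \<open>(1 + \<alpha>) / 2\<close>.\<close>

lemma summable_geometric_poly:
  fixes \<alpha> :: real
  assumes "0 < \<alpha>" "\<alpha> < 1"
  shows "summable (\<lambda>t. \<alpha> ^ t * (1 + real t) ^ n)"
proof -
  have "(\<lambda>t. \<alpha> * ((2 + real t) / (1 + real t)) ^ n) \<longlonglongrightarrow> \<alpha> * 1 ^ n"
    by (intro tendsto_intros) real_asymp
  then have "eventually (\<lambda>t. \<alpha> * ((2 + real t) / (1 + real t)) ^ n < (1 + \<alpha>) / 2) sequentially"
    using assms by (intro order_tendstoD(2)) auto
  then obtain N where N: "\<And>t. t \<ge> N \<Longrightarrow> \<alpha> * ((2 + real t) / (1 + real t)) ^ n < (1 + \<alpha>) / 2"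
    by (auto simp: eventually_sequentially)
  show ?thesis
  proof (rule summable_ratio_test[where N = N and c = "(1 + \<alpha>) / 2"])
    fix t assume "t \<ge> N"
    have "\<alpha> ^ Suc t * (1 + real (Suc t)) ^ n =
        (\<alpha> * ((2 + real t) / (1 + real t)) ^ n) * (\<alpha> ^ t * (1 + real t) ^ n)"
      by (simp add: power_divide add_ac)
    also have "\<dots> \<le> (1 + \<alpha>) / 2 * (\<alpha> ^ t * (1 + real t) ^ n)"
      using N[OF \<open>t \<ge> N\<close>] assms by (intro mult_right_mono) auto
    finally show "norm (\<alpha> ^ Suc t * (1 + real (Suc t)) ^ n)
        \<le> (1 + \<alpha>) / 2 * norm (\<alpha> ^ t * (1 + real t) ^ n)"
      using assms by (simp add: abs_mult)
  qed (use assms in auto)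
qed

subsection \<open>Discounted sums of expectations\<close>

text \<open>Both chains have jumps of at most square-root growth. Then
  \<open>sqrt (1 + norm)\<close> increases by at most \<open>D\<close> per step, so the states
  reached by time \<open>t\<close> are of size O(t^2) and polynomial costs have finite discounted
  sums.\<close>

locale sublinear_chain =
  fixes K :: "int ^ 'd \<Rightarrow> (int ^ 'd) pmf" and \<alpha> D :: real and x :: "int ^ 'd"
  assumes \<alpha>: "0 < \<alpha>" "\<alpha> < 1" and D: "0 \<le> D"
    and jump: "z \<in> set_pmf (K y) \<Longrightarrow> norm (lat z - lat y) \<le> D * sqrt (1 + norm (lat y))"
begin

definition expect :: "nat \<Rightarrow> (int ^ 'd \<Rightarrow> real) \<Rightarrow> real" where
  "expect t f = measure_pmf.expectation (chain_pmf K x t) f"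

text \<open>The resolvent of the chain applied to \<open>f\<close> and evaluated at
  \<open>x\<close>.\<close>

definition dsum :: "(int ^ 'd \<Rightarrow> real) \<Rightarrow> real" where
  "dsum f = (\<Sum>t. \<alpha> ^ t * expect t f)"

section \<open>Growth of the chain in time\<close>

lemma sqrt_step:
  assumes "z \<in> set_pmf (K y)"
  shows "sqrt (1 + norm (lat z)) \<le> sqrt (1 + norm (lat y)) + D"
proof -
  let ?r = "sqrt (1 + norm (lat y))"
  have r: "?r\<^sup>2 = 1 + norm (lat y)" "0 \<le> ?r"
    by auto
  have "norm (lat z) \<le> norm (lat y) + norm (lat z - lat y)"
    by (metis norm_triangle_sub)
  then have "1 + norm (lat z) \<le> ?r\<^sup>2 + D * ?r"
    using jump[OF assms] r by linarith
  \<comment> \<open>Completing the square turns a jump proportional to \<open>?r\<close> into an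
    additive increment of \<open>?r\<close>.\<close>
  also have "\<dots> \<le> (?r + D)\<^sup>2"
    using D r by (simp add: power2_eq_square algebra_simps)
  finally show ?thesis
    using D r by (intro real_le_lsqrt) auto
qed

lemma sqrt_chain:
  assumes "y \<in> set_pmf (chain_pmf K x t)"
  shows "sqrt (1 + norm (lat y)) \<le> sqrt (1 + norm (lat x)) + D * real t"
  using assms
proof (induction t arbitrary: y)
  case (Suc t)
  then obtain z where "z \<in> set_pmf (chain_pmf K x t)" "y \<in> set_pmf (K z)"
    by auto
  then show ?case
    using Suc.IH sqrt_step by (fastforce simp: algebra_simps)
qed simp

lemma finite_step: "finite (set_pmf (K y))"
proof (rule finite_subset[OF _ finite_lat_ball])
  show "set_pmf (K y) \<subseteq> {z. norm (lat z) \<le> norm (lat y) + D * sqrt (1 + norm (lat y))}"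
  proof
    fix z assume "z \<in> set_pmf (K y)"
    then show "z \<in> {z. norm (lat z) \<le> norm (lat y) + D * sqrt (1 + norm (lat y))}"
      using jump[of z y] norm_triangle_sub[of "lat z" "lat y"] by simp
  qed
qed

lemma finite_chain: "finite (set_pmf (chain_pmf K x t))"
  by (induction t) (auto intro: finite_step)

lemma integrable_chain [simp]:
  fixes f :: "int ^ 'd \<Rightarrow> 'b::{banach, second_countable_topology}"
  shows "integrable (measure_pmf (chain_pmf K x t)) f"
  by (rule integrable_measure_pmf_finite[OF finite_chain])

lemma integrable_step [simp]:
  fixes f :: "int ^ 'd \<Rightarrow> 'b::{banach, second_countable_topology}"
  shows "integrable (measure_pmf (K y)) f"
  by (rule integrable_measure_pmf_finite[OF finite_step])

lemma expect_Suc: "expect (Suc t) f = expect t (\<lambda>y. measure_pmf.expectation (K y) f)"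
  unfolding expect_def chain_pmf.simps
  by (subst pmf_expectation_bind[OF finite_chain finite_step order_refl],
      subst integral_measure_pmf[OF finite_chain]) auto

lemma weight_chain:
  assumes "y \<in> set_pmf (chain_pmf K x t)"
  shows "(1 + norm (lat y)) ^ m \<le> (sqrt (1 + norm (lat x)) + D) ^ (2 * m) * (1 + real t) ^ (2 * m)"
proof -
  let ?r = "sqrt (1 + norm (lat x))"
  have "sqrt (1 + norm (lat y)) \<le> ?r + D * real t"
    by (rule sqrt_chain[OF assms])
  also have "\<dots> \<le> (?r + D) * (1 + real t)"
    using D by (simp add: algebra_simps)
  finally have "sqrt (1 + norm (lat y)) ^ (2 * m) \<le> ((?r + D) * (1 + real t)) ^ (2 * m)"
    by (intro power_mono) auto
  then show ?thesis
    by (simp add: power_mult power_mult_distrib)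
qed

lemma poly_chain_bound:
  assumes "poly_growth f"
  obtains C n where "\<And>t y. y \<in> set_pmf (chain_pmf K x t) \<Longrightarrow> \<bar>f y\<bar> \<le> C * (1 + real t) ^ n"
proof -
  obtain A m where A: "0 \<le> A" "\<bar>f y\<bar> \<le> A * (1 + norm (lat y)) ^ m" for y
    using assms unfolding poly_growth_def by blast
  have "\<bar>f y\<bar> \<le> (A * (sqrt (1 + norm (lat x)) + D) ^ (2 * m)) * (1 + real t) ^ (2 * m)"
    if "y \<in> set_pmf (chain_pmf K x t)" for t y
    using A(2)[of y] mult_left_mono[OF weight_chain[OF that, of m] A(1)] by (simp add: mult_ac)
  then show thesis
    using that by blast
qed

lemma summable_expect_abs:
  assumes "poly_growth f"
  shows "summable (\<lambda>t. \<alpha> ^ t * expect t (\<lambda>y. \<bar>f y\<bar>))"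
proof -
  obtain C n where C: "\<And>t y. y \<in> set_pmf (chain_pmf K x t) \<Longrightarrow> \<bar>f y\<bar> \<le> C * (1 + real t) ^ n"
    using poly_chain_bound[OF assms] by blast
  have "expect t (\<lambda>y. \<bar>f y\<bar>) \<le> C * (1 + real t) ^ n" for t
    unfolding expect_def using C
    by (intro measure_pmf.integral_le_const) (auto simp: AE_measure_pmf_iff)
  moreover have "0 \<le> expect t (\<lambda>y. \<bar>f y\<bar>)" for t
    unfolding expect_def by simp
  moreover have "summable (\<lambda>t. C * (\<alpha> ^ t * (1 + real t) ^ n))"
    by (intro summable_mult summable_geometric_poly \<alpha>)
  ultimately show ?thesis
    using \<alpha> by (elim summable_comparison_test') (auto simp: mult.left_commute abs_mult)
qed

lemma summable_expect:
  assumes "poly_growth f"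
  shows "summable (\<lambda>t. \<alpha> ^ t * expect t f)"
proof (rule summable_comparison_test'[OF summable_expect_abs[OF assms]])
  fix t
  have "\<bar>expect t f\<bar> \<le> expect t (\<lambda>y. \<bar>f y\<bar>)"
    unfolding expect_def by (rule integral_abs_bound)
  then show "norm (\<alpha> ^ t * expect t f) \<le> \<alpha> ^ t * expect t (\<lambda>y. \<bar>f y\<bar>)"
    using \<alpha> by (simp add: abs_mult)
qed

section \<open>Calculus of discounted sums\<close>

lemma dsum_const: "dsum (\<lambda>_. a) = a / (1 - \<alpha>)"
proof -
  have "(\<Sum>t. \<alpha> ^ t) = 1 / (1 - \<alpha>)"
    using \<alpha> by (intro suminf_geometric) auto
  then show ?thesis
    using \<alpha> by (simp add: dsum_def expect_def suminf_mult2[symmetric])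
qed

lemma dsum_add:
  assumes "poly_growth f" "poly_growth g"
  shows "dsum (\<lambda>y. f y + g y) = dsum f + dsum g"
proof -
  have "expect t (\<lambda>y. f y + g y) = expect t f + expect t g" for t
    by (simp add: expect_def)
  then show ?thesis
    unfolding dsum_def
    by (simp add: distrib_left suminf_add[OF summable_expect[OF assms(1)] summable_expect[OF assms(2)]])
qed

lemma dsum_cmult: "poly_growth f \<Longrightarrow> dsum (\<lambda>y. a * f y) = a * dsum f"
proof -
  assume f: "poly_growth f"
  have "expect t (\<lambda>y. a * f y) = a * expect t f" for t
    by (simp add: expect_def)
  then show ?thesis
    unfolding dsum_def by (simp add: mult.left_commute suminf_mult[OF summable_expect[OF f]])
qed

lemma dsum_diff:
  assumes "poly_growth f" "poly_growth g"
  shows "dsum (\<lambda>y. f y - g y) = dsum f - dsum g"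
  using dsum_add[OF assms(1) poly_growth_minus[OF assms(2)]] dsum_cmult[OF assms(2), of "-1"] by simp

lemma dsum_divide: "poly_growth f \<Longrightarrow> dsum (\<lambda>y. f y / a) = dsum f / a"
  using dsum_cmult[of f "inverse a"] by (simp add: divide_inverse mult.commute)

lemma dsum_mono:
  assumes "poly_growth f" "poly_growth g" "\<And>y. f y \<le> g y"
  shows "dsum f \<le> dsum g"
  unfolding dsum_def using assms \<alpha>
  by (intro suminf_le summable_expect mult_left_mono) (auto simp: expect_def intro!: integral_mono)

lemma dsum_nonneg: "poly_growth f \<Longrightarrow> (\<And>y. 0 \<le> f y) \<Longrightarrow> 0 \<le> dsum f"
  using dsum_mono[of "\<lambda>_. 0" f] by (simp add: dsum_const poly_growth_const)

lemma dsum_abs_le: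
  assumes "poly_growth g" "\<And>y. \<bar>f y\<bar> \<le> g y"
  shows "\<bar>dsum f\<bar> \<le> dsum g"
proof -
  have f: "poly_growth f"
    by (rule poly_growth_mono[OF assms])
  have "f y \<le> g y" "- f y \<le> g y" for y
    using assms(2)[of y] by auto
  then have "dsum f \<le> dsum g" "- dsum f \<le> dsum g"
    using dsum_mono[OF f assms(1)] dsum_mono[OF poly_growth_minus[OF f] assms(1)]
      dsum_cmult[OF f, of "-1"] by auto
  then show ?thesis
    by linarith
qed

text \<open>One step multiplies \<open>sqrt (1 + norm)\<close> by at most \<open>1 + D\<close>,
  hence a weight of degree \<open>m\<close> by at most \<open>(1 + D) ^ (2 * m)\<close>.\<close>

lemma poly_growth_step:
  assumes "poly_growth f"
  shows "poly_growth (\<lambda>y. measure_pmf.expectation (K y) f)"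
proof -
  obtain A m where A: "0 \<le> A" "\<bar>f y\<bar> \<le> A * (1 + norm (lat y)) ^ m" for y
    using assms unfolding poly_growth_def by blast
  have "\<bar>measure_pmf.expectation (K y) f\<bar> \<le> (A * (1 + D) ^ (2 * m)) * (1 + norm (lat y)) ^ m" for y
  proof -
    let ?r = "sqrt (1 + norm (lat y))"
    have "\<bar>f z\<bar> \<le> (A * (1 + D) ^ (2 * m)) * (1 + norm (lat y)) ^ m" if "z \<in> set_pmf (K y)" for z
    proof -
      have "D * 1 \<le> D * ?r"
        using D by (intro mult_left_mono) auto
      then have "sqrt (1 + norm (lat z)) \<le> (1 + D) * ?r"
        using sqrt_step[OF that] by (simp add: algebra_simps)
      then have "sqrt (1 + norm (lat z)) ^ (2 * m) \<le> ((1 + D) * ?r) ^ (2 * m)"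
        by (intro power_mono) auto
      then have "(1 + norm (lat z)) ^ m \<le> (1 + D) ^ (2 * m) * (1 + norm (lat y)) ^ m"
        by (simp add: power_mult power_mult_distrib)
      then show ?thesis
        using A(2)[of z] mult_left_mono[OF _ A(1)] by (fastforce simp: mult_ac)
    qed
    then have "measure_pmf.expectation (K y) (\<lambda>z. \<bar>f z\<bar>)
        \<le> (A * (1 + D) ^ (2 * m)) * (1 + norm (lat y)) ^ m"
      by (intro measure_pmf.integral_le_const) (auto simp: AE_measure_pmf_iff)
    then show ?thesis
      using integral_abs_bound[of "measure_pmf (K y)" f] by linarith
  qed
  then show ?thesis
    by (rule poly_growthI)
qed

text \<open>Dynkin's formula in resolvent form: split off the term at time 0 and shift the index,
  which turns the remaining sum into \<alpha> times the discounted sum of the one-step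
  expectations.\<close>

lemma dsum_dynkin:
  assumes "poly_growth f"
  shows "(1 - \<alpha>) * dsum f = f x + \<alpha> * dsum (\<lambda>y. measure_pmf.expectation (K y) f - f y)"
proof -
  note K = poly_growth_step[OF assms]
  have "dsum f = expect 0 f + (\<Sum>t. \<alpha> ^ Suc t * expect (Suc t) f)"
    unfolding dsum_def using suminf_split_head[OF summable_expect[OF assms]] by simp
  also have "(\<Sum>t. \<alpha> ^ Suc t * expect (Suc t) f) =
      \<alpha> * dsum (\<lambda>y. measure_pmf.expectation (K y) f)"
    unfolding dsum_def expect_Suc
    by (subst suminf_mult[symmetric]) (auto intro!: summable_expect K simp: mult_ac)
  finally show ?thesis
    by (simp add: expect_def dsum_diff[OF K assms] algebra_simps)
qed

lemma dsum_ge_initial: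
  assumes "poly_growth f" "\<And>y. 0 \<le> f y"
  shows "f x \<le> dsum f"
proof -
  have "f x + \<alpha> * dsum (\<lambda>y. measure_pmf.expectation (K y) f) = dsum f"
    using dsum_dynkin[OF assms(1)] dsum_diff[OF poly_growth_step[OF assms(1)] assms(1)]
    by (simp add: algebra_simps)
  moreover have "0 \<le> dsum (\<lambda>y. measure_pmf.expectation (K y) f)"
    using assms by (intro dsum_nonneg poly_growth_step) auto
  ultimately show ?thesis
    using \<alpha> mult_nonneg_nonneg[of \<alpha> "dsum (\<lambda>y. measure_pmf.expectation (K y) f)"] by linarith
qed

text \<open>With \<open>f x / (1 - \<alpha>)\<close> as the value frozen at the start, Dynkin's
  formula leaves only the discounted generator term, divided by \<open>1 - \<alpha>\<close>.\<close>

lemma dsum_initial_bound: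
  assumes f: "poly_growth f" and g: "poly_growth g"
    and le: "\<And>y. \<bar>measure_pmf.expectation (K y) f - f y\<bar> \<le> g y"
  shows "\<bar>dsum f - f x / (1 - \<alpha>)\<bar> \<le> dsum g / (1 - \<alpha>)"
proof -
  let ?L = "\<lambda>y. measure_pmf.expectation (K y) f - f y"
  have "\<bar>dsum ?L\<bar> \<le> dsum g"
    by (rule dsum_abs_le[OF g le])
  moreover have "\<alpha> * \<bar>dsum ?L\<bar> \<le> 1 * \<bar>dsum ?L\<bar>"
    using \<alpha> by (intro mult_right_mono) auto
  ultimately have "\<bar>(1 - \<alpha>) * dsum f - f x\<bar> \<le> dsum g"
    using \<alpha> dsum_dynkin[OF f] by (simp add: abs_mult)
  moreover have "dsum f - f x / (1 - \<alpha>) = ((1 - \<alpha>) * dsum f - f x) / (1 - \<alpha>)"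
    using \<alpha> by (simp add: diff_divide_distrib)
  ultimately show ?thesis
    using \<alpha> by (simp add: abs_divide divide_right_mono)
qed

text \<open>Sum and integral may be exchanged because the polynomial bound on the supports makes the
  series absolutely summable, both along almost every path and in expectation.\<close>

lemma integral_discounted:
  assumes "poly_growth f"
  shows "(LINT \<omega>|chain_law K x. (\<Sum>t. \<alpha> ^ t * f (\<omega> t))) = dsum f"
proof -
  have i: "integrable (chain_law K x) (\<lambda>\<omega>. \<alpha> ^ t * g (\<omega> t))" for t and g :: "int ^ 'd \<Rightarrow> real"
    by (intro integrable_mult_right integrable_chain_law_coord integrable_chain)
  have e: "(LINT \<omega>|chain_law K x. \<alpha> ^ t * g (\<omega> t)) = \<alpha> ^ t * expect t g"
    for t and g :: "int ^ 'd \<Rightarrow> real"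
    by (simp add: expect_def integral_chain_law_coord)
  obtain C n where C: "\<And>t y. y \<in> set_pmf (chain_pmf K x t) \<Longrightarrow> \<bar>f y\<bar> \<le> C * (1 + real t) ^ n"
    using poly_chain_bound[OF assms] by blast
  \<comment> \<open>The bound holds on the support at each time; as there are countably many times,
    it holds at all of them along almost every path.\<close>
  have "AE \<omega> in chain_law K x. \<forall>t. \<bar>f (\<omega> t)\<bar> \<le> C * (1 + real t) ^ n"
    using C by (subst AE_all_countable) (auto intro!: AE_chain_law_coord)
  then have "AE \<omega> in chain_law K x. summable (\<lambda>t. norm (\<alpha> ^ t * f (\<omega> t)))"
  proof eventually_elim
    case (elim \<omega>)
    have "summable (\<lambda>t. C * (\<alpha> ^ t * (1 + real t) ^ n))"
      by (intro summable_mult summable_geometric_poly \<alpha>)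
    then show ?case
      by (rule summable_comparison_test')
        (use \<alpha> elim in \<open>auto simp: abs_mult mult.left_commute[of C]\<close>)
  qed
  moreover have "summable (\<lambda>t. LINT \<omega>|chain_law K x. norm (\<alpha> ^ t * f (\<omega> t)))"
    using summable_expect_abs[OF assms] \<alpha>
    by (simp add: abs_mult e[of _ "\<lambda>y. \<bar>f y\<bar>"] del: integral_mult_right_zero)
  ultimately have "(LINT \<omega>|chain_law K x. (\<Sum>t. \<alpha> ^ t * f (\<omega> t))) =
      (\<Sum>t. LINT \<omega>|chain_law K x. \<alpha> ^ t * f (\<omega> t))"
    by (intro integral_suminf i) auto
  then show ?thesis
    by (simp add: e dsum_def del: integral_mult_right_zero)
qed

lemma discounted_value_eq: "poly_growth c \<Longrightarrow> discounted_value K \<alpha> c x = dsum c"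
  unfolding discounted_value_def by (rule integral_discounted)

lemma weighted_value_eq:
  assumes "poly_growth c" "0 \<le> \<epsilon>"
  shows "weighted_value K \<alpha> c \<epsilon> x = dsum (\<lambda>y. \<bar>c y\<bar> / (1 + norm (lat y)) powr \<epsilon>)"
  unfolding weighted_value_def by (intro integral_discounted poly_growth_weighted assms)

end

subsection \<open>Chains with small drift\<close>

text \<open>Away from the origin \<open>1 + norm\<close> is at most \<open>2 * norm\<close>, which
  gives the factor 2. The indicator removes the origin, which matters for \<open>k = 1\<close>:
  there \<open>0 ^ 0 = 1\<close> while the cost may vanish.\<close>

lemma norm_le_weighted:
  assumes "norm (lat y) ^ k \<le> \<Gamma> * c" "1 \<le> k" "0 < \<Gamma>" "0 \<le> c"
  shows "norm (lat y) ^ (k - 1) * of_bool (y \<noteq> 0) \<le> 2 * \<Gamma> * (c / (1 + norm (lat y)))"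
proof (cases "y = 0")
  case True
  then show ?thesis
    using assms by simp
next
  case False
  let ?n = "norm (lat y)"
  have n: "1 \<le> ?n"
    using False by (rule one_le_norm_lat)
  have "?n ^ (k - 1) * (1 + ?n) \<le> ?n ^ (k - 1) * (2 * ?n)"
    using n by (intro mult_left_mono) auto
  also have "\<dots> = 2 * ?n ^ k"
    using assms(2) by (cases k) auto
  also have "\<dots> \<le> 2 * \<Gamma> * c"
    using assms(1) by simp
  finally have "?n ^ (k - 1) \<le> 2 * \<Gamma> * c / (1 + ?n)"
    using n by (simp add: pos_le_divide_eq)
  then show ?thesis
    using False by simp
qed

text \<open>The summand 1 covers the origin, where the left side is 1 and the cost may vanish;
  elsewhere \<open>1 + norm\<close> is at most \<open>2 * norm\<close>.\<close>

lemma weight_le_weighted: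
  assumes "norm (lat y) ^ k \<le> \<Gamma> * c" "1 \<le> k" "0 < \<Gamma>" "0 \<le> c"
  shows "(1 + norm (lat y)) ^ (k - 1) \<le> 1 + 2 ^ k * \<Gamma> * (c / (1 + norm (lat y)))"
proof (cases "y = 0")
  case True
  then show ?thesis
    using assms by simp
next
  case False
  let ?n = "norm (lat y)"
  have n: "1 \<le> ?n"
    using False by (rule one_le_norm_lat)
  have "(1 + ?n) ^ (k - 1) * (1 + ?n) = (1 + ?n) ^ k"
    using assms(2) by (cases k) auto
  also have "\<dots> \<le> (2 * ?n) ^ k"
    using n by (intro power_mono) auto
  also have "\<dots> \<le> 2 ^ k * (\<Gamma> * c)"
    using assms(1) by (simp add: power_mult_distrib)
  finally have "(1 + ?n) ^ (k - 1) \<le> 2 ^ k * (\<Gamma> * c) / (1 + ?n)"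
    using n by (subst pos_le_divide_eq) auto
  then show ?thesis
    by (simp add: mult_ac)
qed

text \<open>The variant for \<open>k = 1\<close> and the exponent \<epsilon>. At the origin the left
  side is 0; elsewhere the factor 2 comes from \<open>2 powr \<epsilon> \<le> 2\<close>.\<close>

lemma norm_powr_le_weighted:
  assumes "norm (lat y) \<le> \<Gamma> * c" "0 < \<epsilon>" "\<epsilon> < 1" "0 < \<Gamma>" "0 \<le> c"
  shows "norm (lat y) powr (1 - \<epsilon>) \<le> 2 * \<Gamma> * (c / (1 + norm (lat y)) powr \<epsilon>)"
proof (cases "y = 0")
  case True
  then show ?thesis
    using assms by simp
next
  case False
  let ?n = "norm (lat y)"
  have n: "1 \<le> ?n"
    using False by (rule one_le_norm_lat)
  have "(1 + ?n) powr \<epsilon> \<le> (2 * ?n) powr \<epsilon>"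
    using n assms by (intro powr_mono2) auto
  also have "\<dots> = 2 powr \<epsilon> * ?n powr \<epsilon>"
    by (simp add: powr_mult)
  also have "\<dots> \<le> 2 powr 1 * ?n powr \<epsilon>"
    using assms by (intro mult_right_mono powr_mono) auto
  finally have "?n powr (1 - \<epsilon>) * (1 + ?n) powr \<epsilon> \<le> ?n powr (1 - \<epsilon>) * (2 * ?n powr \<epsilon>)"
    by (intro mult_left_mono) auto
  also have "\<dots> = 2 * ?n"
    using n by (simp flip: powr_add)
  also have "\<dots> \<le> 2 * \<Gamma> * c"
    using assms by simp
  finally have "?n powr (1 - \<epsilon>) \<le> 2 * \<Gamma> * c / (1 + ?n) powr \<epsilon>"
    using n by (subst pos_le_divide_eq) auto
  then show ?thesis
    by simp
qed

lemma weighted_growth: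
  assumes "poly_growth c" "\<And>y. 0 \<le> c y"
  shows "poly_growth (\<lambda>y. c y / (1 + norm (lat y)))"
proof (rule poly_growth_mono[OF assms(1)])
  fix y
  have "c y / (1 + norm (lat y)) \<le> c y / 1"
    using assms(2) by (intro divide_left_mono) (auto intro: add_pos_nonneg)
  then show "\<bar>c y / (1 + norm (lat y))\<bar> \<le> c y"
    using assms(2) by simp
qed

text \<open>Both chains are instances, since they share their drift. Here \<open>s\<^sup>2\<close>
  is the total mass of the discount weights; second moments are left open and enter the lemmas below
  through separate hypotheses.\<close>

locale small_drift_chain = sublinear_chain K \<alpha> D x
  for K :: "int ^ 'd \<Rightarrow> (int ^ 'd) pmf" and \<alpha> D :: real and x :: "int ^ 'd" +
  fixes s \<Gamma> :: real
  assumes s: "1 \<le> s" "1 - \<alpha> = 1 / s\<^sup>2" and \<Gamma>: "0 < \<Gamma>"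
    and drift: "norm (measure_pmf.expectation (K y) (\<lambda>z. lat z - lat y)) \<le> \<Gamma> / s"
begin

lemma dsum_const': "dsum (\<lambda>_. a) = a * s\<^sup>2"
  by (simp add: dsum_const s(2))

lemma inner_drift:
  "\<bar>measure_pmf.expectation (K y) (\<lambda>z. v \<bullet> (lat z - lat y))\<bar> \<le> norm v * (\<Gamma> / s)"
proof -
  have "measure_pmf.expectation (K y) (\<lambda>z. v \<bullet> (lat z - lat y)) =
      v \<bullet> measure_pmf.expectation (K y) (\<lambda>z. lat z - lat y)"
    by (rule integral_inner_right) simp
  also have "\<bar>\<dots>\<bar> \<le> norm v * norm (measure_pmf.expectation (K y) (\<lambda>z. lat z - lat y))"
    by (rule Cauchy_Schwarz_ineq2)
  also have "\<dots> \<le> norm v * (\<Gamma> / s)"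
    by (intro mult_left_mono drift) auto
  finally show ?thesis .
qed

text \<open>The squared distance has an exact quadratic expansion. The centre \<open>v\<close> will
  be the initial state in the displacement bound and the origin in the ellipticity bound.\<close>

lemma expectation_sq_diff:
  "measure_pmf.expectation (K y) (\<lambda>z. (norm (lat z - v))\<^sup>2) - (norm (lat y - v))\<^sup>2 =
    2 * measure_pmf.expectation (K y) (\<lambda>z. (lat y - v) \<bullet> (lat z - lat y)) +
    measure_pmf.expectation (K y) (\<lambda>z. (norm (lat z - lat y))\<^sup>2)"
proof -
  have "(norm (lat z - v))\<^sup>2 = (norm (lat y - v))\<^sup>2 +
      (2 * ((lat y - v) \<bullet> (lat z - lat y)) + (norm (lat z - lat y))\<^sup>2)" for z
    by (simp add: power2_norm_eq_inner inner_diff_left inner_diff_right inner_commute)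
  then have "measure_pmf.expectation (K y) (\<lambda>z. (norm (lat z - v))\<^sup>2) =
      measure_pmf.expectation (K y) (\<lambda>z. (norm (lat y - v))\<^sup>2 +
      (2 * ((lat y - v) \<bullet> (lat z - lat y)) + (norm (lat z - lat y))\<^sup>2))"
    by (intro Bochner_Integration.integral_cong refl)
  then show ?thesis
    by simp
qed

lemma poly_growth_dist2: "poly_growth (\<lambda>y. (norm (lat y - v))\<^sup>2)"
proof (rule poly_growth_mono)
  show "poly_growth (\<lambda>y. (norm (lat y) + norm v)\<^sup>2)"
    by (intro poly_growth_intros)
  show "\<bar>(norm (lat y - v))\<^sup>2\<bar> \<le> (norm (lat y) + norm v)\<^sup>2" for y
    using power_mono[OF norm_triangle_ineq4[of "lat y" v]] by simp
qed

text \<open>Dynkin's formula for the squared distance from the start, which vanishes at the start.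
  Young's inequality splits the drift term so that its quadratic part is absorbed by half of the
  left side.\<close>

lemma dsum_displacement:
  assumes b: "poly_growth b" "\<And>y z. z \<in> set_pmf (K y) \<Longrightarrow> (norm (lat z - lat y))\<^sup>2 \<le> b y"
  shows "dsum (\<lambda>y. (norm (lat y - lat x))\<^sup>2) \<le> 2 * s\<^sup>2 * (2 * \<Gamma>\<^sup>2 * s\<^sup>2 + dsum b)"
proof -
  let ?h = "\<lambda>y. (norm (lat y - lat x))\<^sup>2"
  let ?q = "\<lambda>y. ?h y / (2 * s\<^sup>2) + (2 * \<Gamma>\<^sup>2 + b y)"
  have h: "poly_growth ?h"
    by (rule poly_growth_dist2)
  have q: "poly_growth ?q"
    by (intro poly_growth_intros h b(1))
  \<comment> \<open>The support is nonempty, so \<open>b\<close> dominates some square.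
    Nonnegativity of \<open>?q\<close> then allows \<alpha> to be replaced by 1 below.\<close>
  have b0: "0 \<le> b y" for y
  proof -
    obtain z where "z \<in> set_pmf (K y)"
      using set_pmf_not_empty by fastforce
    then show ?thesis
      using b(2) by (meson order_trans zero_le_power2)
  qed
  have le: "measure_pmf.expectation (K y) ?h - ?h y \<le> ?q y" for y
  proof -
    let ?n = "norm (lat y - lat x)"
    have "measure_pmf.expectation (K y) (\<lambda>z. (norm (lat z - lat y))\<^sup>2) \<le> b y"
      using b(2) by (intro measure_pmf.integral_le_const) (auto simp: AE_measure_pmf_iff)
    \<comment> \<open>The coefficient \<open>1 / (2 * s\<^sup>2)\<close> is half of
      \<open>1 - \<alpha>\<close>, the factor on the left of Dynkin's formula.\<close>
    moreover have "2 * (?n * (\<Gamma> / s)) \<le> ?n\<^sup>2 / (2 * s\<^sup>2) + 2 * \<Gamma>\<^sup>2"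
    proof -
      have "0 \<le> (?n / s - 2 * \<Gamma>)\<^sup>2"
        by simp
      also have "\<dots> = ?n\<^sup>2 / s\<^sup>2 - 4 * (?n * (\<Gamma> / s)) + 4 * \<Gamma>\<^sup>2"
        by (simp add: power2_diff power_divide power_mult_distrib)
      finally show ?thesis
        by simp
    qed
    ultimately show ?thesis
      using inner_drift[of y "lat y - lat x"] unfolding expectation_sq_diff by linarith
  qed
  have "0 \<le> dsum ?q"
    using b0 by (intro dsum_nonneg q) auto
  have "dsum ?h / s\<^sup>2 = \<alpha> * dsum (\<lambda>y. measure_pmf.expectation (K y) ?h - ?h y)"
    using dsum_dynkin[OF h] by (simp add: s(2))
  also have "\<dots> \<le> \<alpha> * dsum ?q"
    using \<alpha> le by (intro mult_left_mono dsum_mono poly_growth_diff poly_growth_step h q) auto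
  also have "\<dots> \<le> 1 * dsum ?q"
    using \<alpha> \<open>0 \<le> dsum ?q\<close> by (intro mult_right_mono) auto
  also have "dsum ?q = dsum ?h / (2 * s\<^sup>2) + (2 * \<Gamma>\<^sup>2 * s\<^sup>2 + dsum b)"
    by (simp add: dsum_add dsum_divide dsum_const' h b poly_growth_intros)
  finally have "dsum ?h / (2 * s\<^sup>2) \<le> 2 * \<Gamma>\<^sup>2 * s\<^sup>2 + dsum b"
    by (simp add: field_simps)
  then show ?thesis
    using s(1) by (simp add: pos_divide_le_eq mult.commute)
qed

text \<open>For \<open>k = 1\<close> the Hessian of the cost need not decay, so that a second order expansion is too
  weak; the cost is compared with its initial value through the displacement instead.\<close>

lemma dsum_Lipschitz:
  assumes \<epsilon>: "0 < \<epsilon>" "\<epsilon> < 1" and \<beta>: "0 \<le> \<beta>" and L: "0 \<le> L"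
    and jump2: "\<And>y z. z \<in> set_pmf (K y) \<Longrightarrow>
      (norm (lat z - lat y))\<^sup>2 \<le> \<beta> * (1 + norm (lat y) powr (1 - \<epsilon>) / s)"
    and c: "poly_growth c" "\<And>y. 0 \<le> c y" "\<And>y. norm (lat y) \<le> \<Gamma> * c y"
    and lip: "\<And>y. \<bar>c y - c x\<bar> \<le> L * norm (lat y - lat x)"
  shows "\<bar>dsum c - s\<^sup>2 * c x\<bar> \<le>
    L * (1 + 4 * \<Gamma>\<^sup>2 + 2 * \<beta>) * s ^ 3 +
    4 * L * \<beta> * \<Gamma> * dsum (\<lambda>y. c y / (1 + norm (lat y)) powr \<epsilon>)"
proof -
  let ?h = "\<lambda>y. (norm (lat y - lat x))\<^sup>2"
  let ?r = "\<lambda>y :: int ^ 'd. norm (lat y) powr (1 - \<epsilon>)"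
  let ?w = "\<lambda>y. c y / (1 + norm (lat y)) powr \<epsilon>"
  have h: "poly_growth ?h"
    by (rule poly_growth_dist2)
  have r: "poly_growth ?r"
    using \<epsilon> by (intro poly_growth_norm_powr) auto
  have w: "poly_growth ?w"
    using poly_growth_weighted[OF c(1), of \<epsilon>] c(2) \<epsilon> by simp
  have rw: "dsum ?r \<le> 2 * \<Gamma> * dsum ?w"
  proof -
    have "dsum ?r \<le> dsum (\<lambda>y. 2 * \<Gamma> * ?w y)"
      by (intro dsum_mono r poly_growth_mult poly_growth_const w)
        (rule norm_powr_le_weighted[OF c(3) \<epsilon> \<Gamma> c(2)])
    also have "\<dots> = 2 * \<Gamma> * dsum ?w"
      by (rule dsum_cmult[OF w])
    finally show ?thesis .
  qed
  have "dsum ?h \<le> 2 * s\<^sup>2 * (2 * \<Gamma>\<^sup>2 * s\<^sup>2 + dsum (\<lambda>y. \<beta> * (1 + ?r y / s)))"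
    by (intro dsum_displacement jump2 poly_growth_intros) (use \<epsilon> in auto)
  also have "dsum (\<lambda>y. \<beta> * (1 + ?r y / s)) = \<beta> * (s\<^sup>2 + dsum ?r / s)"
    by (simp add: dsum_cmult dsum_add dsum_divide dsum_const' r poly_growth_intros)
  finally have "dsum ?h / s \<le> (2 * s\<^sup>2 * (2 * \<Gamma>\<^sup>2 * s\<^sup>2 + \<beta> * (s\<^sup>2 + dsum ?r / s))) / s"
    using s(1) by (intro divide_right_mono) auto
  also have "\<dots> = (4 * \<Gamma>\<^sup>2 + 2 * \<beta>) * s ^ 3 + 2 * \<beta> * dsum ?r"
    using s(1) by (simp add: field_simps power2_eq_square power3_eq_cube)
  also have "\<dots> \<le> (4 * \<Gamma>\<^sup>2 + 2 * \<beta>) * s ^ 3 + 2 * \<beta> * (2 * \<Gamma> * dsum ?w)"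
    using \<beta> rw by (intro add_left_mono mult_left_mono) auto
  finally have H: "dsum ?h / s \<le> (4 * \<Gamma>\<^sup>2 + 2 * \<beta>) * s ^ 3 + 4 * \<beta> * \<Gamma> * dsum ?w"
    by simp
  \<comment> \<open>Trading the distance for its square makes the displacement estimate applicable.
    At the length scale \<open>s\<close> both summands have discounted sums of order
    \<open>s ^ 3\<close>, apart from the weighted value.\<close>
  have "\<bar>c y - c x\<bar> \<le> L * (s + ?h y / s)" for y
  proof -
    let ?n = "norm (lat y - lat x)"
    have "2 * (?n * s) \<le> ?n\<^sup>2 + s\<^sup>2"
      using sum_squares_bound[of ?n s] by (simp add: mult.assoc)
    then have "?n * s \<le> s\<^sup>2 + ?n\<^sup>2"
      using s(1) by (smt (verit) mult_nonneg_nonneg norm_ge_zero)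
    then have "?n \<le> s + ?h y / s"
      using s(1) by (simp add: field_simps power2_eq_square)
    then show ?thesis
      using lip[of y] L by (meson mult_left_mono order_trans)
  qed
  then have "\<bar>dsum (\<lambda>y. c y - c x)\<bar> \<le> dsum (\<lambda>y. L * (s + ?h y / s))"
    by (intro dsum_abs_le poly_growth_intros h)
  also have "\<dots> = L * (s * s\<^sup>2 + dsum ?h / s)"
    by (simp add: dsum_cmult dsum_add dsum_divide dsum_const' h poly_growth_intros)
  also have "\<dots> \<le> L * (s * s\<^sup>2 + ((4 * \<Gamma>\<^sup>2 + 2 * \<beta>) * s ^ 3 + 4 * \<beta> * \<Gamma> * dsum ?w))"
    using L H by (intro mult_left_mono add_left_mono) auto
  finally show ?thesis
    by (simp add: dsum_diff c(1) poly_growth_const dsum_const' algebra_simps power2_eq_square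
        power3_eq_cube)
qed

text \<open>With \<open>u = 1 + norm (lat y)\<close> and up to constants, the drift contributes
  \<open>u ^ (k - 1) / s\<close> to the one-step change of the cost, and the Taylor remainder
  contributes \<open>u ^ (k - 2) * (1 + u / s)\<close>. By \<open>dsum_initial_bound\<close> the
  discounted sum of these bounds is multiplied by \<open>s\<^sup>2\<close>.\<close>

lemma dsum_second_order:
  assumes \<epsilon>: "0 < \<epsilon>" "\<epsilon> < 1" and \<beta>: "0 \<le> \<beta>" and L: "0 \<le> L" and k: "2 \<le> k"
    and jump2: "\<And>y z. z \<in> set_pmf (K y) \<Longrightarrow>
      (norm (lat z - lat y))\<^sup>2 \<le> \<beta> * (1 + norm (lat y) powr (1 - \<epsilon>) / s)"
    and c: "poly_growth c" "\<And>y. 0 \<le> c y" "\<And>y. norm (lat y) ^ k \<le> \<Gamma> * c y"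
    and g: "\<And>y. norm (g y) \<le> L * (1 + norm (lat y)) ^ (k - 1)"
    and taylor: "\<And>y z. z \<in> set_pmf (K y) \<Longrightarrow> \<bar>c z - c y - g y \<bullet> (lat z - lat y)\<bar> \<le>
      L * (1 + norm (lat y)) ^ (k - 2) * (norm (lat z - lat y))\<^sup>2"
  shows "\<bar>dsum c - s\<^sup>2 * c x\<bar> \<le> L * (\<Gamma> + 3 * \<beta>) * s ^ (k + 2) +
    L * (\<Gamma> + 2 * \<beta>) * 2 ^ k * \<Gamma> * s * dsum (\<lambda>y. c y / (1 + norm (lat y)))"
proof -
  let ?w = "\<lambda>y. c y / (1 + norm (lat y))"
  let ?W = "\<lambda>y. L * (\<Gamma> + 2 * \<beta>) / s * (1 + 2 ^ k * \<Gamma> * ?w y) + L * \<beta> * s ^ (k - 2)"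
  have w: "poly_growth ?w"
    by (rule weighted_growth[OF c(1,2)])
  have W: "poly_growth ?W"
    by (intro poly_growth_intros w)
  have "\<bar>measure_pmf.expectation (K y) c - c y\<bar> \<le> ?W y" for y
  proof -
    let ?u = "1 + norm (lat y)"
    let ?R = "L * ?u ^ (k - 2) * (\<beta> * (1 + ?u / s))"
    have u: "1 \<le> ?u"
      by simp
    have pw: "norm (lat y) powr (1 - \<epsilon>) \<le> ?u"
    proof -
      have "norm (lat y) powr (1 - \<epsilon>) \<le> ?u powr (1 - \<epsilon>)"
        using \<epsilon> by (intro powr_mono2) auto
      also have "\<dots> \<le> ?u powr 1"
        using \<epsilon> by (intro powr_mono) auto
      finally show ?thesis
        by simp
    qed
    have R: "\<bar>c z - c y - g y \<bullet> (lat z - lat y)\<bar> \<le> ?R" if "z \<in> set_pmf (K y)" for z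
    proof -
      have "(norm (lat z - lat y))\<^sup>2 \<le> \<beta> * (1 + norm (lat y) powr (1 - \<epsilon>) / s)"
        by (rule jump2[OF that])
      also have "\<dots> \<le> \<beta> * (1 + ?u / s)"
        using \<beta> pw s(1) by (intro mult_left_mono add_left_mono divide_right_mono) auto
      finally show ?thesis
        using taylor[OF that] L by (elim order_trans, intro mult_left_mono) auto
    qed
    have "\<bar>measure_pmf.expectation (K y) (\<lambda>z. c z - c y - g y \<bullet> (lat z - lat y))\<bar>
        \<le> measure_pmf.expectation (K y) (\<lambda>z. \<bar>c z - c y - g y \<bullet> (lat z - lat y)\<bar>)"
      by (rule integral_abs_bound)
    also have "\<dots> \<le> ?R"
      using R by (intro measure_pmf.integral_le_const) (auto simp: AE_measure_pmf_iff)
    finally have 1: "\<bar>measure_pmf.expectation (K y) c - c y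
        - measure_pmf.expectation (K y) (\<lambda>z. g y \<bullet> (lat z - lat y))\<bar> \<le> ?R"
      by simp
    have "\<bar>measure_pmf.expectation (K y) (\<lambda>z. g y \<bullet> (lat z - lat y))\<bar> \<le> norm (g y) * (\<Gamma> / s)"
      by (rule inner_drift)
    also have "\<dots> \<le> L * ?u ^ (k - 1) * (\<Gamma> / s)"
      using g \<Gamma> s(1) by (intro mult_right_mono) auto
    finally have 2: "\<bar>measure_pmf.expectation (K y) (\<lambda>z. g y \<bullet> (lat z - lat y))\<bar>
        \<le> L * ?u ^ (k - 1) * (\<Gamma> / s)" .
    have k': "?u ^ (k - 1) = ?u ^ (k - 2) * ?u"
      using k by (metis Suc_diff_le diff_Suc_Suc numeral_2_eq_2 One_nat_def power_Suc2)
    \<comment> \<open>Beyond the length scale \<open>s\<close> an extra factor \<open>?u / s\<close>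
      is at least 1; below it \<open>?u\<close> is replaced by \<open>s\<close>.\<close>
    have "?u ^ (k - 2) \<le> ?u ^ (k - 1) / s + s ^ (k - 2)"
    proof (cases "s \<le> ?u")
      case True
      have "?u ^ (k - 2) * s \<le> ?u ^ (k - 1)"
        unfolding k' using True by (intro mult_left_mono) auto
      then have "?u ^ (k - 2) \<le> ?u ^ (k - 1) / s"
        using s(1) by (simp add: pos_le_divide_eq)
      moreover have "0 \<le> s ^ (k - 2)"
        using s(1) by simp
      ultimately show ?thesis
        by linarith
    next
      case False
      then have "?u ^ (k - 2) \<le> s ^ (k - 2)"
        by (intro power_mono) auto
      moreover have "0 \<le> ?u ^ (k - 1) / s"
        using s(1) by simp
      ultimately show ?thesis
        by linarith
    qed
    then have "L * \<beta> * ?u ^ (k - 2) \<le> L * \<beta> * (?u ^ (k - 1) / s + s ^ (k - 2))"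
      using L \<beta> by (intro mult_left_mono) auto
    then have "L * \<beta> * ?u ^ (k - 2) \<le> L * \<beta> * (?u ^ (k - 1) / s) + L * \<beta> * s ^ (k - 2)"
      by (simp only: distrib_left)
    moreover have "?R = L * \<beta> * ?u ^ (k - 2) + L * \<beta> * (?u ^ (k - 1) / s)"
      unfolding k' by (simp add: algebra_simps)
    moreover have "L * (\<Gamma> + 2 * \<beta>) / s * ?u ^ (k - 1) =
        L * ?u ^ (k - 1) * (\<Gamma> / s) + 2 * (L * \<beta> * (?u ^ (k - 1) / s))"
      by (simp add: algebra_simps add_divide_distrib)
    ultimately have "?R + L * ?u ^ (k - 1) * (\<Gamma> / s)
        \<le> L * (\<Gamma> + 2 * \<beta>) / s * ?u ^ (k - 1) + L * \<beta> * s ^ (k - 2)"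
      by linarith
    also have "\<dots> \<le> ?W y"
      using L \<beta> \<Gamma> s(1) k weight_le_weighted[OF c(3) _ \<Gamma> c(2)]
      by (intro add_right_mono mult_left_mono) auto
    finally show ?thesis
      using 1 2 by linarith
  qed
  then have "\<bar>dsum c - s\<^sup>2 * c x\<bar> \<le> s\<^sup>2 * dsum ?W"
    using dsum_initial_bound[OF c(1) W] by (simp add: s(2) mult.commute)
  also have "dsum ?W = L * (\<Gamma> + 2 * \<beta>) / s * (s\<^sup>2 + 2 ^ k * \<Gamma> * dsum ?w) + L * \<beta> * s ^ (k - 2) * s\<^sup>2"
    using w by (subst dsum_add, intro poly_growth_intros w, intro poly_growth_intros w)
      (subst dsum_cmult, intro poly_growth_intros w,
       subst dsum_add, intro poly_growth_intros w, intro poly_growth_intros w,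
       subst dsum_cmult, simp_all add: dsum_const')
  also have "s\<^sup>2 * \<dots> = L * (\<Gamma> + 2 * \<beta>) * s ^ 3 + L * \<beta> * s ^ (k + 2) +
      L * (\<Gamma> + 2 * \<beta>) * 2 ^ k * \<Gamma> * s * dsum ?w"
  proof -
    obtain j where j: "k = j + 2"
      using k by (metis add.commute le_Suc_ex)
    show ?thesis
      using s(1) unfolding j by (simp add: field_simps power2_eq_square power3_eq_cube)
  qed
  \<comment> \<open>The cubic term stems from the summand 1 in \<open>weight_le_weighted\<close>; it
    is merged into the leading power.\<close>
  also have "L * (\<Gamma> + 2 * \<beta>) * s ^ 3 \<le> L * (\<Gamma> + 2 * \<beta>) * s ^ (k + 2)"
    using L \<Gamma> \<beta> s(1) k by (intro mult_left_mono power_increasing) auto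
  finally show ?thesis
    by (simp add: algebra_simps)
qed

section \<open>Lower bounds for the weighted value\<close>

lemma weighted_ge_initial:
  assumes k: "1 \<le> k" and c: "poly_growth c" "\<And>y. 0 \<le> c y" "\<And>y. norm (lat y) ^ k \<le> \<Gamma> * c y"
    and x: "x \<noteq> 0"
  shows "1 \<le> 2 * \<Gamma> * dsum (\<lambda>y. c y / (1 + norm (lat y)))"
proof -
  \<comment> \<open>Only the term at time 0 is kept; this is enough as long as \<open>s\<close>
    stays bounded.\<close>
  have "1 \<le> norm (lat x) ^ (k - 1)"
    using one_le_norm_lat[OF x] by simp
  also have "\<dots> \<le> 2 * \<Gamma> * (c x / (1 + norm (lat x)))"
    using norm_le_weighted[OF c(3) k \<Gamma> c(2), of x] x by simp
  also have "\<dots> \<le> 2 * \<Gamma> * dsum (\<lambda>y. c y / (1 + norm (lat y)))"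
    using \<Gamma> c(2) dsum_ge_initial[OF weighted_growth[OF c(1,2)]] by (intro mult_left_mono) auto
  finally show ?thesis .
qed

text \<open>Chebyshev's inequality in pointwise form: with \<open>n\<close> the initial norm and
  \<open>h\<close> the squared displacement, \<open>1 - 4 / n\<^sup>2 * h\<close> is at most the
  indicator of \<open>norm (lat y) \<ge> n / 2\<close>. At least half of the discount mass therefore
  lies at distance \<open>n / 2\<close> or more from the origin.\<close>

lemma weighted_ge_far:
  assumes k: "1 \<le> k" and c: "poly_growth c" "\<And>y. 0 \<le> c y" "\<And>y. norm (lat y) ^ k \<le> \<Gamma> * c y"
    and H: "dsum (\<lambda>y. (norm (lat y - lat x))\<^sup>2) \<le> H * s ^ 4" "8 * H \<le> s\<^sup>2" "0 \<le> H"
    and x: "s ^ 4 \<le> norm (lat x)"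
  shows "s ^ (k + 1) \<le> 2 ^ (k + 1) * \<Gamma> * dsum (\<lambda>y. c y / (1 + norm (lat y)))"
proof -
  let ?n = "norm (lat x)"
  let ?r = "?n / 2"
  let ?w = "\<lambda>y. c y / (1 + norm (lat y))"
  let ?h = "\<lambda>y. (norm (lat y - lat x))\<^sup>2"
  have w: "poly_growth ?w"
    by (rule weighted_growth[OF c(1,2)])
  have h: "poly_growth ?h"
    by (rule poly_growth_dist2)
  have n: "1 \<le> ?n"
    using x one_le_power[OF s(1), of 4] by linarith
  have "?r ^ (k - 1) * (1 - 4 / ?n\<^sup>2 * ?h y) \<le> 2 * \<Gamma> * ?w y" for y
  proof (cases "?r \<le> norm (lat y)")
    case True
    then have "y \<noteq> 0"
      using n by auto
    have "?r ^ (k - 1) * (1 - 4 / ?n\<^sup>2 * ?h y) \<le> ?r ^ (k - 1) * 1"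
      by (intro mult_left_mono) auto
    also have "\<dots> \<le> norm (lat y) ^ (k - 1)"
      using True by (simp add: power_mono)
    also have "\<dots> \<le> 2 * \<Gamma> * ?w y"
      using norm_le_weighted[OF c(3) k \<Gamma> c(2), of y] \<open>y \<noteq> 0\<close> by simp
    finally show ?thesis .
  next
    case False
    \<comment> \<open>A state within half the initial norm has moved by at least the other
      half.\<close>
    then have "?r \<le> norm (lat y - lat x)"
      using norm_triangle_sub[of "lat x" "lat y"] by (simp add: norm_minus_commute)
    then have "?r\<^sup>2 \<le> ?h y"
      by (intro power_mono) auto
    then have "?n\<^sup>2 \<le> 4 * ?h y"
      by (simp add: power_divide)
    moreover have "0 < ?n\<^sup>2"
      using n by (intro zero_less_power) linarith
    ultimately have "1 \<le> 4 * ?h y / ?n\<^sup>2"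
      by (simp only: pos_le_divide_eq mult_1)
    then have "1 - 4 / ?n\<^sup>2 * ?h y \<le> 0"
      by simp
    then have "?r ^ (k - 1) * (1 - 4 / ?n\<^sup>2 * ?h y) \<le> 0"
      by (intro mult_nonneg_nonpos) auto
    also have "0 \<le> 2 * \<Gamma> * ?w y"
      using \<Gamma> c(2) by simp
    finally show ?thesis .
  qed
  then have "dsum (\<lambda>y. ?r ^ (k - 1) * (1 - 4 / ?n\<^sup>2 * ?h y)) \<le> dsum (\<lambda>y. 2 * \<Gamma> * ?w y)"
    by (intro dsum_mono poly_growth_intros h w)
  also have "dsum (\<lambda>y. ?r ^ (k - 1) * (1 - 4 / ?n\<^sup>2 * ?h y)) =
      ?r ^ (k - 1) * (s\<^sup>2 - 4 / ?n\<^sup>2 * dsum ?h)"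
    using h by (subst dsum_cmult, intro poly_growth_intros h,
      subst dsum_diff, intro poly_growth_intros h, intro poly_growth_intros h,
      subst dsum_cmult, simp_all add: dsum_const')
  also have "dsum (\<lambda>y. 2 * \<Gamma> * ?w y) = 2 * \<Gamma> * dsum ?w"
    by (rule dsum_cmult[OF w])
  finally have 1: "?r ^ (k - 1) * (s\<^sup>2 - 4 / ?n\<^sup>2 * dsum ?h) \<le> 2 * \<Gamma> * dsum ?w" .
  \<comment> \<open>The mass lost in Chebyshev's inequality is at most \<open>4 * H\<close>, which
    is at most half of the total mass \<open>s\<^sup>2\<close>.\<close>
  have "4 / ?n\<^sup>2 * dsum ?h \<le> s\<^sup>2 / 2"
  proof -
    have "s ^ 4 * 1 \<le> ?n * ?n"
      using x n by (intro mult_mono) auto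
    then have "H * s ^ 4 \<le> H * ?n\<^sup>2"
      using H(3) by (intro mult_left_mono) (auto simp: power2_eq_square)
    then have "4 / ?n\<^sup>2 * dsum ?h \<le> 4 / ?n\<^sup>2 * (H * ?n\<^sup>2)"
      using H(1) by (intro mult_left_mono) auto
    also have "\<dots> = 4 * H"
      using n by auto
    finally show ?thesis
      using H(2) by linarith
  qed
  then have "?r ^ (k - 1) * (s\<^sup>2 / 2) \<le> ?r ^ (k - 1) * (s\<^sup>2 - 4 / ?n\<^sup>2 * dsum ?h)"
    by (intro mult_left_mono) auto
  from order_trans[OF this 1] have 2: "?r ^ (k - 1) * s\<^sup>2 \<le> 4 * \<Gamma> * dsum ?w"
    by simp
  have "s ^ (k + 1) = s ^ (k - 1) * s\<^sup>2"
    using k by (simp flip: power_add)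
  also have "\<dots> \<le> ?n ^ (k - 1) * s\<^sup>2"
  proof -
    have "s \<le> s ^ 4"
      using s(1) by (rule self_le_power) simp
    then have "s ^ (k - 1) \<le> ?n ^ (k - 1)"
      using x s(1) by (intro power_mono) auto
    then show ?thesis
      by (intro mult_right_mono) auto
  qed
  also have "\<dots> = 2 ^ (k - 1) * (?r ^ (k - 1) * s\<^sup>2)"
    by (simp add: power_divide)
  also have "\<dots> \<le> 2 ^ (k - 1) * (4 * \<Gamma> * dsum ?w)"
    using 2 by (intro mult_left_mono) auto
  also have "\<dots> = 2 ^ (k - 1 + 2) * \<Gamma> * dsum ?w"
    by (simp add: power_add)
  also have "k - 1 + 2 = k + 1"
    using k by simp
  finally show ?thesis .
qed

text \<open>Each step adds at least \<open>lam\<close> to the expected squared norm, up to the drift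
  term. The drift cancels at most half of this and a multiple of
  \<open>norm\<^sup>2 / s\<^sup>2\<close>, whose discounted sum is moved to the other side and
  yields the factor \<open>1 + 2 * \<Gamma>\<^sup>2 / lam\<close>.\<close>

lemma dsum_norm2_ge:
  assumes lam: "0 < lam" and \<alpha>2: "1 / 2 \<le> \<alpha>"
    and elliptic: "\<And>y. lam \<le> measure_pmf.expectation (K y) (\<lambda>z. (norm (lat z - lat y))\<^sup>2)"
  shows "lam / (4 * (1 + 2 * \<Gamma>\<^sup>2 / lam)) * s ^ 4 \<le> dsum (\<lambda>y. (norm (lat y))\<^sup>2)"
proof -
  let ?f = "\<lambda>y :: int ^ 'd. (norm (lat y))\<^sup>2"
  let ?m = "2 * \<Gamma>\<^sup>2 / lam"
  have f: "poly_growth ?f"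
    by (intro poly_growth_intros)
  have f0: "0 \<le> dsum ?f"
    by (intro dsum_nonneg f) auto
  have "lam / 2 - ?m / s\<^sup>2 * ?f y \<le> measure_pmf.expectation (K y) ?f - ?f y" for y
  proof -
    let ?n = "norm (lat y)"
    \<comment> \<open>The weights in the square make Young's inequality spend exactly
      \<open>lam / 2\<close>.\<close>
    have "0 \<le> (sqrt (lam / 2) - sqrt (2 / lam) * (\<Gamma> * ?n / s))\<^sup>2"
      by simp
    also have "\<dots> = lam / 2 + ?m / s\<^sup>2 * ?f y - 2 * (?n * (\<Gamma> / s))"
      using lam s(1)
      by (simp add: power2_diff power_mult_distrib power_divide real_sqrt_mult[symmetric] mult_ac)
    finally show ?thesis
      using expectation_sq_diff[of y 0] inner_drift[of y "lat y"] elliptic[of y] by simp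
  qed
  then have "dsum (\<lambda>y. lam / 2 - ?m / s\<^sup>2 * ?f y) \<le>
      dsum (\<lambda>y. measure_pmf.expectation (K y) ?f - ?f y)"
    by (intro dsum_mono poly_growth_intros poly_growth_step f)
  also have "dsum (\<lambda>y. lam / 2 - ?m / s\<^sup>2 * ?f y) = lam / 2 * s\<^sup>2 - ?m / s\<^sup>2 * dsum ?f"
    by (subst dsum_diff, intro poly_growth_intros, intro poly_growth_intros,
        subst dsum_cmult, intro poly_growth_intros, simp add: dsum_const')
  finally have "\<alpha> * (lam / 2 * s\<^sup>2 - ?m / s\<^sup>2 * dsum ?f) \<le>
      \<alpha> * dsum (\<lambda>y. measure_pmf.expectation (K y) ?f - ?f y)"
    using \<alpha> by (intro mult_left_mono) auto
  also have "\<dots> \<le> dsum ?f / s\<^sup>2"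
    using dsum_dynkin[OF f] by (simp add: s(2))
  finally have 1: "\<alpha> * (lam / 2 * s\<^sup>2) \<le> dsum ?f / s\<^sup>2 + \<alpha> * (?m / s\<^sup>2 * dsum ?f)"
    by (simp add: algebra_simps)
  have "\<alpha> * (?m / s\<^sup>2 * dsum ?f) \<le> 1 * (?m / s\<^sup>2 * dsum ?f)"
    using \<alpha> lam f0 by (intro mult_right_mono) auto
  moreover have "1 / 2 * (lam / 2 * s\<^sup>2) \<le> \<alpha> * (lam / 2 * s\<^sup>2)"
    using \<alpha>2 lam by (intro mult_right_mono) auto
  ultimately have "lam / 4 * s\<^sup>2 \<le> (1 + ?m) * dsum ?f / s\<^sup>2"
    using 1 by (simp add: algebra_simps add_divide_distrib)
  then have "lam / 4 * (s\<^sup>2 * s\<^sup>2) \<le> (1 + ?m) * dsum ?f"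
    using s(1) by (simp add: pos_le_divide_eq mult_ac)
  moreover have "s\<^sup>2 * s\<^sup>2 = s ^ 4"
    by (simp flip: power_add)
  moreover have "0 < 1 + ?m"
    using lam by (intro add_pos_nonneg) auto
  ultimately have "lam / 4 * s ^ 4 / (1 + ?m) \<le> dsum ?f"
    by (simp only: pos_divide_le_eq mult.commute[of "1 + ?m"])
  then show ?thesis
    by (simp only: times_divide_eq_left divide_divide_eq_left)
qed

text \<open>Here \<open>k = j + 3\<close>. A second moment of order \<open>s ^ 4\<close> over the
  mass \<open>s\<^sup>2\<close> means a typical distance of order \<open>s\<close>; splitting at
  \<open>\<delta> * s\<close> turns it into a lower bound for the moment of order
  \<open>k - 1\<close>, which \<open>norm_le_weighted\<close> compares with the weighted
  cost.\<close>

lemma weighted_ge_elliptic: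
  assumes lam: "0 < lam" and \<alpha>2: "1 / 2 \<le> \<alpha>"
    and elliptic: "\<And>y. lam \<le> measure_pmf.expectation (K y) (\<lambda>z. (norm (lat z - lat y))\<^sup>2)"
    and c: "poly_growth c" "\<And>y. 0 \<le> c y" "\<And>y. norm (lat y) ^ (j + 3) \<le> \<Gamma> * c y"
    and \<delta>: "\<delta> = sqrt (lam / (8 * (1 + 2 * \<Gamma>\<^sup>2 / lam)))"
  shows "\<delta> ^ (j + 2) * s ^ (j + 4) \<le> 2 * \<Gamma> * dsum (\<lambda>y. c y / (1 + norm (lat y)))"
proof -
  let ?w = "\<lambda>y. c y / (1 + norm (lat y))"
  let ?f = "\<lambda>(n::nat) (y :: int ^ 'd). norm (lat y) ^ n"
  have w: "poly_growth ?w"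
    by (rule weighted_growth[OF c(1,2)])
  have f: "poly_growth (?f n)" for n
    by (intro poly_growth_intros)
  have m: "0 < 1 + 2 * \<Gamma>\<^sup>2 / lam"
    using lam by (intro add_pos_nonneg) auto
  have \<delta>0: "0 < \<delta>"
    unfolding \<delta> using lam m by simp
  have \<delta>2: "\<delta>\<^sup>2 = lam / (8 * (1 + 2 * \<Gamma>\<^sup>2 / lam))"
    unfolding \<delta> using lam m by simp
  have ds: "0 < \<delta> * s"
    using \<delta>0 s(1) by simp
  have "?f 2 y \<le> ?f (j + 2) y / (\<delta> * s) ^ j + (\<delta> * s)\<^sup>2" for y
  proof (cases "\<delta> * s \<le> norm (lat y)")
    case True
    have "?f 2 y * (\<delta> * s) ^ j \<le> ?f 2 y * ?f j y"
      using True ds by (intro mult_left_mono power_mono) auto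
    also have "?f 2 y * ?f j y = ?f (j + 2) y"
      by (simp only: power_add mult.commute)
    finally have "?f 2 y \<le> ?f (j + 2) y / (\<delta> * s) ^ j"
      using ds by (simp only: pos_le_divide_eq zero_less_power)
    then show ?thesis
      by (smt (verit) zero_le_power2)
  next
    case False
    then have "?f 2 y \<le> (\<delta> * s)\<^sup>2"
      by (intro power_mono) auto
    moreover have "0 \<le> ?f (j + 2) y / (\<delta> * s) ^ j"
      using ds by simp
    ultimately show ?thesis
      by linarith
  qed
  then have "dsum (?f 2) \<le> dsum (\<lambda>y. ?f (j + 2) y / (\<delta> * s) ^ j + (\<delta> * s)\<^sup>2)"
    by (intro dsum_mono poly_growth_add poly_growth_divide poly_growth_const f)
  also have "\<dots> = dsum (?f (j + 2)) / (\<delta> * s) ^ j + (\<delta> * s)\<^sup>2 * s\<^sup>2"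
    by (simp only: dsum_add dsum_divide dsum_const' f poly_growth_divide poly_growth_const)
  also have "(\<delta> * s)\<^sup>2 * s\<^sup>2 = \<delta>\<^sup>2 * s ^ 4"
    by (simp add: power_mult_distrib flip: power_add)
  \<comment> \<open>The choice of \<open>\<delta>\<close> makes this lower bound twice the share
    \<open>\<delta>\<^sup>2 * s ^ 4\<close> allotted to the states closer than
    \<open>\<delta> * s\<close>.\<close>
  also have "dsum (?f 2) \<ge> 2 * \<delta>\<^sup>2 * s ^ 4"
  proof -
    have "lam / (4 * m) = 2 * (lam / (8 * m))" for m
      by simp
    then show ?thesis
      using dsum_norm2_ge[OF lam \<alpha>2 elliptic] unfolding \<delta>2 by presburger
  qed
  finally have "\<delta>\<^sup>2 * s ^ 4 \<le> dsum (?f (j + 2)) / (\<delta> * s) ^ j"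
    by simp
  then have "\<delta>\<^sup>2 * s ^ 4 * (\<delta> * s) ^ j \<le> dsum (?f (j + 2))"
    using ds by (simp add: pos_le_divide_eq)
  also have "\<dots> \<le> dsum (\<lambda>y. 2 * \<Gamma> * ?w y)"
  proof (intro dsum_mono poly_growth_mult poly_growth_const f w)
    show "?f (j + 2) y \<le> 2 * \<Gamma> * ?w y" for y
      using norm_le_weighted[OF c(3) _ \<Gamma> c(2), of y] \<Gamma> c(2)[of y] by (cases "y = 0") auto
  qed
  also have "\<dots> = 2 * \<Gamma> * dsum ?w"
    by (rule dsum_cmult[OF w])
  finally show ?thesis
    by (simp add: power_add power_mult_distrib power2_eq_square mult_ac)
qed

end

subsection \<open>Local moments of the chain and of its sister\<close>

lemma max_jump_le_iff:
  "max_jump K x \<le> ereal b \<longleftrightarrow> (\<forall>z\<in>set_pmf (K x). norm (lat z - lat x) \<le> b)"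
  by (auto simp: max_jump_def SUP_le_iff pmf_positive_iff[symmetric] set_pmf_iff less_le)

lemma local_mean_eq:
  "local_mean K x = measure_pmf.expectation (K x) (\<lambda>z. lat z - lat x)"
  unfolding local_mean_def
  using integral_chain_law_coord[of K x "\<lambda>z. lat z - lat x" 1] by (simp add: bind_return_pmf)

lemma local_second_nth:
  fixes K :: "int ^ 'd \<Rightarrow> (int ^ 'd) pmf"
  assumes "finite (set_pmf (K x))"
  shows "local_second K x $ i $ j =
    measure_pmf.expectation (K x) (\<lambda>z. (lat z - lat x) $ i * (lat z - lat x) $ j)"
proof -
  let ?f = "\<lambda>z. \<chi> i j. (lat z - lat x) $ i * (lat z - lat x) $ j"
  have "local_second K x = measure_pmf.expectation (K x) ?f"
    unfolding local_second_def
    using integral_chain_law_coord[of K x ?f 1] by (simp add: bind_return_pmf)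
  then show ?thesis
    using assms by (simp add: integral_measure_pmf[OF assms])
qed

text \<open>Testing the form with one unit vector bounds a diagonal entry from below, and the square
  of one coordinate is at most the squared norm.\<close>

lemma local_second_elliptic:
  fixes K :: "int ^ 'd \<Rightarrow> (int ^ 'd) pmf"
  assumes fin: "finite (set_pmf (K x))"
    and elliptic: "\<And>\<xi>. lam * (norm \<xi>)\<^sup>2 \<le>
      (\<Sum>i\<in>UNIV. \<Sum>j\<in>UNIV. \<xi> $ i * \<xi> $ j * local_second K x $ i $ j)"
  shows "lam \<le> measure_pmf.expectation (K x) (\<lambda>z. (norm (lat z - lat x))\<^sup>2)"
proof -
  fix i :: 'd
  have "lam \<le> (\<Sum>a\<in>UNIV. \<Sum>b\<in>UNIV. axis i 1 $ a * axis i 1 $ b * local_second K x $ a $ b)"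
    using elliptic[of "axis i 1"] by (simp add: norm_axis_1)
  also have "\<dots> = local_second K x $ i $ i"
    by (simp add: axis_def if_distrib[of "\<lambda>t. t * _"] if_distrib[of "\<lambda>t. _ * t"] cong: if_cong)
  also have "\<dots> = measure_pmf.expectation (K x) (\<lambda>z. (lat z - lat x) $ i * (lat z - lat x) $ i)"
    by (rule local_second_nth[of K x, OF fin])
  also have "\<dots> \<le> measure_pmf.expectation (K x) (\<lambda>z. (norm (lat z - lat x))\<^sup>2)"
  proof (intro integral_mono integrable_measure_pmf_finite fin)
    fix z
    have "\<bar>(lat z - lat x) $ i\<bar>\<^sup>2 \<le> (norm (lat z - lat x))\<^sup>2"
      by (intro power_mono component_le_norm_cart) auto
    then show "(lat z - lat x) $ i * (lat z - lat x) $ i \<le> (norm (lat z - lat x))\<^sup>2"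
      by (simp add: power2_eq_square)
  qed
  finally show ?thesis .
qed

text \<open>Conditionally on the state \<open>w\<close> reached by \<open>P\<close>, the
  representatives average to \<open>w\<close>, so the second stage of the transition leaves the mean
  unchanged.\<close>

lemma sister_chain_mean:
  assumes zm: "zero_mean_construction M rep G"
    and fin: "finite (set_pmf (sister_chain P G rep y))" "finite (set_pmf (P y))"
  shows "measure_pmf.expectation (sister_chain P G rep y) (\<lambda>z. lat z - lat y) =
    measure_pmf.expectation (P y) (\<lambda>z. lat z - lat y)"
proof -
  have S: "sister_chain P G rep y = P y \<bind> (\<lambda>w. map_pmf rep (G w))"
    by (simp add: sister_chain_def U_matrix_def map_pmf_def)
  \<comment> \<open>Injectivity of \<open>rep\<close> carries finiteness from the support of the
    sister chain back to the meta-states.\<close>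
  have finG: "finite (set_pmf (G w))" if "w \<in> set_pmf (P y)" for w
  proof (rule finite_imageD)
    show "finite (rep ` set_pmf (G w))"
      by (rule finite_subset[OF _ fin(1)]) (use that in \<open>auto simp: S\<close>)
    show "inj_on rep (set_pmf (G w))"
      using zm by (auto simp: zero_mean_construction_def intro: inj_on_subset)
  qed
  have "measure_pmf.expectation (map_pmf rep (G w)) (\<lambda>z. lat z - lat y) = lat w - lat y"
    if w: "w \<in> set_pmf (P y)" for w
  proof -
    have "((\<lambda>l. pmf (G w) l *\<^sub>R lat (rep l)) has_sum lat w) M" "set_pmf (G w) \<subseteq> M"
      using zm by (auto simp: zero_mean_construction_def)
    then have "((\<lambda>l. pmf (G w) l *\<^sub>R lat (rep l)) has_sum lat w) (set_pmf (G w))"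
      by (subst has_sum_cong_neutral[where T = M]) (auto simp: set_pmf_iff)
    then have "lat w = (\<Sum>l\<in>set_pmf (G w). pmf (G w) l *\<^sub>R lat (rep l))"
      using has_sum_finite[OF finG[OF w]] has_sum_unique by blast
    also have "\<dots> = measure_pmf.expectation (G w) (\<lambda>l. lat (rep l))"
      by (simp add: integral_measure_pmf[OF finG[OF w]])
    finally show ?thesis
      by (simp add: integrable_measure_pmf_finite[OF finG[OF w]])
  qed
  moreover have "measure_pmf.expectation (sister_chain P G rep y) (\<lambda>z. lat z - lat y) =
      (\<Sum>w\<in>set_pmf (P y). pmf (P y) w *\<^sub>R
        measure_pmf.expectation (map_pmf rep (G w)) (\<lambda>z. lat z - lat y))"
    unfolding S by (rule pmf_expectation_bind[OF fin(2)]) (auto intro: finG)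
  ultimately show ?thesis
    by (simp add: integral_measure_pmf[OF fin(2)])
qed

subsection \<open>Consequences of the bounds on the primitives\<close>

lemma sup_norm_leD: "sup_norm f r \<le> ereal b \<Longrightarrow> norm x < r \<Longrightarrow> norm (f x) \<le> b"
  by (auto simp: sup_norm_def SUP_le_iff)

text \<open>In the extended reals an empty supremum would be minus infinity; the origin and a point
  at distance \<open>r / 2\<close> provide a pair. This allows the Lipschitz term to be dropped from
  a bound on a sum.\<close>

lemma lip_seminorm_nonneg:
  assumes "0 < r"
  shows "0 \<le> lip_seminorm (f :: real ^ 'd \<Rightarrow> 'b::real_normed_vector) r"
proof -
  fix i :: 'd
  let ?y = "(r / 2) *\<^sub>R axis i 1 :: real ^ 'd"
  have y: "norm ?y = r / 2"
    using assms by simp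
  have "0 \<le> ereal (norm (f ?y - f 0) / norm (?y - 0))"
    by simp
  also have "\<dots> \<le> lip_seminorm f r"
    unfolding lip_seminorm_def using assms y
    by (intro SUP_upper2[where i = "(0, ?y)"]) auto
  finally show ?thesis .
qed

lemma sup_norm_lip_leD:
  assumes "ereal a * sup_norm f r + ereal b * lip_seminorm f r \<le> ereal \<Gamma>"
    and "0 \<le> a" "0 \<le> b" "norm x < r"
  shows "a * norm (f x) \<le> \<Gamma>"
proof -
  have r: "0 < r"
    using assms(4) norm_ge_zero[of x] by linarith
  have "ereal (norm (f x)) \<le> sup_norm f r"
    unfolding sup_norm_def using assms(4) by (intro SUP_upper) auto
  then have "ereal a * ereal (norm (f x)) \<le> ereal a * sup_norm f r"
    using assms(2) by (intro ereal_mult_left_mono) auto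
  also have "\<dots> \<le> ereal a * sup_norm f r + ereal b * lip_seminorm f r"
    using assms(3) lip_seminorm_nonneg[OF r, of f] by (simp add: add_increasing2)
  finally show ?thesis
    using assms(1) by (metis ereal_less_eq(3) order_trans times_ereal.simps(1))
qed

lemma norm_matrix_vector_mult_le:
  fixes A :: "real ^ 'n ^ 'm"
  shows "norm (A *v h) \<le> norm A * norm h"
proof -
  have "norm (A *v h) \<le> L2_set (\<lambda>i. norm (A $ i) * norm h) UNIV"
    unfolding norm_vec_def[of "A *v h"]
    by (intro L2_set_mono) (auto simp: matrix_mult_dot Cauchy_Schwarz_ineq2)
  also have "\<dots> = norm A * norm h"
    by (simp add: norm_vec_def[of A] L2_set_left_distrib)
  finally show ?thesis .
qed

lemma gradient_bound:
  fixes f :: "'a::real_inner \<Rightarrow> real"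
  assumes "convex S" "\<And>w. w \<in> S \<Longrightarrow> (f has_derivative (\<lambda>h. g w \<bullet> h)) (at w)"
    and "\<And>w. w \<in> S \<Longrightarrow> norm (g w) \<le> B" "y \<in> S" "z \<in> S"
  shows "\<bar>f z - f y\<bar> \<le> B * norm (z - y)"
proof -
  have "norm (f z - f y) \<le> B * norm (z - y)"
  proof (rule differentiable_bound[OF assms(1) _ _ assms(5,4)])
    show "(f has_derivative (\<lambda>h. g w \<bullet> h)) (at w within S)" if "w \<in> S" for w
      using assms(2)[OF that] by (rule has_derivative_at_withinI)
    show "onorm (\<lambda>h. g w \<bullet> h) \<le> B" if "w \<in> S" for w
    proof (rule onorm_bound)
      show "0 \<le> B"
        using assms(3)[OF that] norm_ge_zero order_trans by blast
      fix h
      have "norm (g w \<bullet> h) \<le> norm (g w) * norm h"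
        using Cauchy_Schwarz_ineq2 by simp
      also have "\<dots> \<le> B * norm h"
        by (intro mult_right_mono assms(3) that) simp
      finally show "norm (g w \<bullet> h) \<le> B * norm h" .
    qed
  qed
  then show ?thesis
    by simp
qed

text \<open>The Hessian bound makes the gradient Lipschitz on the ball; the mean value inequality is
  then applied on the segment to \<open>f\<close> minus its linear part at \<open>y\<close>.\<close>

lemma second_order_bound:
  fixes f :: "real ^ 'd \<Rightarrow> real"
  assumes f: "\<And>w. (f has_derivative (\<lambda>h. g w \<bullet> h)) (at w)"
    and g: "\<And>w. (g has_derivative (\<lambda>h. A w *v h)) (at w)"
    and A: "\<And>w. norm w < r \<Longrightarrow> norm (A w) \<le> B" and yz: "norm y < r" "norm z < r"
  shows "\<bar>f z - f y - g y \<bullet> (z - y)\<bar> \<le> B * (norm (z - y))\<^sup>2"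
proof -
  let ?S = "closed_segment y z"
  have S: "norm w < r \<and> norm (w - y) \<le> norm (z - y)" if "w \<in> ?S" for w
  proof -
    have "?S \<subseteq> ball 0 r"
      using yz by (intro closed_segment_subset) auto
    then show ?thesis
      using that segment_bound(1)[OF that] by auto
  qed
  have B: "0 \<le> B"
    using A[OF yz(1)] norm_ge_zero order_trans by blast
  have "norm (g w - g y) \<le> B * norm (z - y)" if "w \<in> ?S" for w
  proof -
    have "norm (g w - g y) \<le> B * norm (w - y)"
    proof (rule differentiable_bound[where S = "ball 0 r"])
      show "(g has_derivative (\<lambda>h. A v *v h)) (at v within ball 0 r)" for v
        using g by (rule has_derivative_at_withinI)
      show "onorm (\<lambda>h. A v *v h) \<le> B" if "v \<in> ball 0 r" for v
      proof (rule onorm_le)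
        fix h
        have "norm (A v *v h) \<le> norm (A v) * norm h"
          by (rule norm_matrix_vector_mult_le)
        also have "\<dots> \<le> B * norm h"
          using that by (intro mult_right_mono A) auto
        finally show "norm (A v *v h) \<le> B * norm h" .
      qed
    qed (use yz S[OF that] in auto)
    also have "\<dots> \<le> B * norm (z - y)"
      using S[OF that] B by (intro mult_left_mono) auto
    finally show ?thesis .
  qed
  then have "\<bar>(f z - g y \<bullet> z) - (f y - g y \<bullet> y)\<bar> \<le> B * norm (z - y) * norm (z - y)"
    by (intro gradient_bound[where S = ?S and g = "\<lambda>w. g w - g y"])
      (auto intro!: derivative_eq_intros f simp: inner_diff_left)
  then show ?thesis
    by (simp add: inner_diff_right power2_eq_square mult.assoc)
qed

text \<open>For \<open>k = 1\<close> the gradient bound has exponent 0 and is therefore the same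
  number on every ball.\<close>

lemma smooth_cost_Lipschitz:
  assumes "smooth_cost 1 \<Gamma> c"
  shows "\<bar>c z - c y\<bar> \<le> 2 * \<Gamma> * norm (z - y)"
proof -
  obtain Dc where Dc: "\<And>x. (c has_derivative (\<lambda>h. Dc x \<bullet> h)) (at x)"
    "\<And>r. r > 0 \<Longrightarrow> sup_norm Dc r \<le> ereal (\<Gamma> * (1 + r powi (int 1 - 1)))"
    using assms unfolding smooth_cost_def by blast
  have "norm (Dc w) \<le> 2 * \<Gamma>" for w
    using sup_norm_leD[OF Dc(2)[of "norm w + 1"], of w]
    by (simp add: add_nonneg_pos)
  then show ?thesis
    by (intro gradient_bound[where S = UNIV and g = Dc] Dc(1)) auto
qed

text \<open>Both end points lie in the ball of radius \<open>(1 + A) * (1 + norm y)\<close>, where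
  the Hessian is controlled. For \<open>k \<ge> 2\<close> the exponents are natural numbers and the
  factor 2 absorbs the summand 1 of the bounds.\<close>

lemma smooth_cost_second_order:
  assumes "smooth_cost k \<Gamma> c" "2 \<le> k" "0 < \<Gamma>"
  obtains g where "\<And>y. norm (g y) \<le> 2 * \<Gamma> * (1 + norm y) ^ (k - 1)"
    "\<And>y z A. 0 \<le> A \<Longrightarrow> norm (z - y) \<le> A * (1 + norm y) \<Longrightarrow>
      \<bar>c z - c y - g y \<bullet> (z - y)\<bar> \<le>
        2 * \<Gamma> * (1 + A) ^ (k - 2) * (1 + norm y) ^ (k - 2) * (norm (z - y))\<^sup>2"
proof -
  obtain Dc D2c where D: "\<And>x. (c has_derivative (\<lambda>h. Dc x \<bullet> h)) (at x)"
    "\<And>x. (Dc has_derivative (\<lambda>h. D2c x *v h)) (at x)"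
    "\<And>r. r > 0 \<Longrightarrow> sup_norm Dc r \<le> ereal (\<Gamma> * (1 + r powi (int k - 1)))"
    "\<And>r. r > 0 \<Longrightarrow> sup_norm D2c r \<le> ereal (\<Gamma> * (1 + r powi (int k - 2)))"
    using assms(1) unfolding smooth_cost_def by blast
  have powi: "r powi (int k - 1) = r ^ (k - 1)" "r powi (int k - 2) = r ^ (k - 2)" for r :: real
    using assms(2) by (simp_all add: power_int_def nat_diff_distrib)
  have le: "\<Gamma> * (1 + r ^ n) \<le> 2 * \<Gamma> * r ^ n" if "1 \<le> r" for r n
    using assms(3) one_le_power[OF that, of n] by simp
  show thesis
  proof
    fix y
    have "norm (Dc y) \<le> \<Gamma> * (1 + (1 + norm y) ^ (k - 1))"
      using sup_norm_leD[OF D(3)[of "1 + norm y"], of y] by (simp add: powi add_pos_nonneg)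
    also have "\<dots> \<le> 2 * \<Gamma> * (1 + norm y) ^ (k - 1)"
      by (rule le) simp
    finally show "norm (Dc y) \<le> 2 * \<Gamma> * (1 + norm y) ^ (k - 1)" .
  next
    fix y z :: "real ^ 'a" and A :: real
    assume A: "0 \<le> A" and z: "norm (z - y) \<le> A * (1 + norm y)"
    let ?r = "(1 + A) * (1 + norm y)"
    have r: "1 \<le> ?r"
      using A mult_mono[of 1 "1 + A" 1 "1 + norm y"] by simp
    have "norm (D2c w) \<le> 2 * \<Gamma> * ?r ^ (k - 2)" if "norm w < ?r" for w
      using sup_norm_leD[OF D(4) that] le[OF r, of "k - 2"] r by (simp add: powi)
    moreover have "norm y < ?r"
    proof -
      have "1 * (1 + norm y) \<le> ?r"
        using A by (intro mult_right_mono) auto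
      then show ?thesis
        by simp
    qed
    moreover have "norm z < ?r"
      using z norm_triangle_sub[of z y] by (simp add: distrib_right)
    ultimately have "\<bar>c z - c y - Dc y \<bullet> (z - y)\<bar> \<le> 2 * \<Gamma> * ?r ^ (k - 2) * (norm (z - y))\<^sup>2"
      by (rule second_order_bound[OF D(1,2)])
    then show "\<bar>c z - c y - Dc y \<bullet> (z - y)\<bar> \<le>
        2 * \<Gamma> * (1 + A) ^ (k - 2) * (1 + norm y) ^ (k - 2) * (norm (z - y))\<^sup>2"
      by (simp add: power_mult_distrib mult.assoc)
  qed
qed

subsection \<open>Uniform estimates\<close>

text \<open>The part of the Primitives Assumption that concerns the cost alone and hence serves both
  chains.\<close>

definition cost_bounds :: "nat \<Rightarrow> real \<Rightarrow> (int ^ 'd \<Rightarrow> real) \<Rightarrow> bool" where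
  "cost_bounds k \<Gamma> c \<longleftrightarrow>
    (\<exists>c'. (\<forall>y. c' (lat y) = c y) \<and> norm_like k \<Gamma> c' \<and> smooth_cost k \<Gamma> c')"

lemma cost_boundsD:
  assumes "cost_bounds k \<Gamma> c" "0 < \<Gamma>"
  shows "poly_growth c" "0 \<le> c y" "norm (lat y) ^ k \<le> \<Gamma> * c y"
proof -
  obtain c' where c': "\<And>y. c' (lat y) = c y" "norm_like k \<Gamma> c'"
    using assms(1) unfolding cost_bounds_def by blast
  have *: "0 \<le> c y" "1 / \<Gamma> * norm (lat y) ^ k \<le> \<bar>c y\<bar>" "\<bar>c y\<bar> \<le> \<Gamma> * (1 + norm (lat y)) ^ k" for y
    using c'(2)[unfolded norm_like_def, rule_format, of "lat y"] unfolding c'(1) by blast+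
  show "poly_growth c"
    using *(3) by (rule poly_growthI)
  show "0 \<le> c y" "norm (lat y) ^ k \<le> \<Gamma> * c y"
    using *(1,2)[of y] assms(2) by (auto simp: field_simps)
qed

text \<open>The drift bound is written with \<open>1 / sqrt (1 - \<alpha>)\<close> because this is
  the value of \<open>s\<close> in \<open>small_drift_chain\<close>.\<close>

lemma primitives_assumptionD:
  assumes prim: "primitives_assumption k \<Gamma> lam \<alpha> P c" and \<alpha>: "\<alpha> < 1"
  shows "cost_bounds k \<Gamma> c"
    and "norm (measure_pmf.expectation (P y) (\<lambda>z. lat z - lat y)) \<le> \<Gamma> / (1 / sqrt (1 - \<alpha>))"
    and "finite (set_pmf (P y)) \<Longrightarrow>
      lam \<le> measure_pmf.expectation (P y) (\<lambda>z. (norm (lat z - lat y))\<^sup>2)"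
proof -
  obtain \<mu> \<sigma>2 c' where
    \<mu>: "\<And>x. \<mu> (lat x) = local_mean P x" and
    \<sigma>2: "\<And>x. \<sigma>2 (lat x) = local_second P x" and
    c': "\<And>x. c' (lat x) = c x" "norm_like k \<Gamma> c'" "smooth_cost k \<Gamma> c'" and
    bound: "\<And>r. r > 0 \<Longrightarrow> ereal ((1 - \<alpha>) powr (-1/2)) * sup_norm \<mu> r
      + ereal ((1 - \<alpha>) powr (-1)) * lip_seminorm \<mu> r \<le> ereal \<Gamma>" and
    elliptic: "\<And>x \<xi>. (\<Sum>i\<in>UNIV. \<Sum>j\<in>UNIV. \<xi> $ i * \<xi> $ j * \<sigma>2 x $ i $ j) \<ge> lam * (norm \<xi>)\<^sup>2"
    using prim unfolding primitives_assumption_def by blast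
  show "cost_bounds k \<Gamma> c"
    unfolding cost_bounds_def using c' by blast
  have "(1 - \<alpha>) powr (-1/2) * norm (\<mu> (lat y)) \<le> \<Gamma>"
    by (rule sup_norm_lip_leD[OF bound[of "norm (lat y) + 1"]]) (auto intro: add_nonneg_pos)
  moreover have "(1 - \<alpha>) powr (-1/2) = 1 / sqrt (1 - \<alpha>)"
    using \<alpha> by (simp add: powr_minus_divide powr_half_sqrt)
  ultimately show "norm (measure_pmf.expectation (P y) (\<lambda>z. lat z - lat y)) \<le>
      \<Gamma> / (1 / sqrt (1 - \<alpha>))"
    using \<alpha> by (simp add: \<mu> local_mean_eq pos_divide_le_eq)
  show "lam \<le> measure_pmf.expectation (P y) (\<lambda>z. (norm (lat z - lat y))\<^sup>2)"
    if "finite (set_pmf (P y))"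
    by (rule local_second_elliptic[of P y, OF that]) (use elliptic[where x = "lat y"] in \<open>simp add: \<sigma>2\<close>)
qed

text \<open>Since \<open>(1 - \<epsilon>) / 2\<close> is below \<open>1 / 2\<close>, the jumps grow
  at most like a square root. Squaring by \<open>(1 + q)\<^sup>2 \<le> 2 * (1 + q\<^sup>2)\<close>
  turns the power \<open>1/4\<close> of \<open>1 - \<alpha>\<close> into the factor
  \<open>1 / s\<close>.\<close>

lemma jump_sqrt_bound:
  assumes "0 < \<alpha>" "\<alpha> < 1" "0 < \<epsilon>" "\<epsilon> < 1" "0 \<le> B"
    and jump: "d \<le> B * (1 + (1 - \<alpha>) powr (1/4) * n powr ((1 - \<epsilon>) / 2))" and "0 \<le> d" "0 \<le> n"
  shows "d \<le> 2 * B * sqrt (1 + n)"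
    and "d\<^sup>2 \<le> 2 * B\<^sup>2 * (1 + n powr (1 - \<epsilon>) / (1 / sqrt (1 - \<alpha>)))"
proof -
  let ?q = "(1 - \<alpha>) powr (1/4) * n powr ((1 - \<epsilon>) / 2)"
  have "(1 - \<alpha>) powr (1/4) \<le> 1"
    using assms by (intro powr_le1) auto
  moreover have "n powr ((1 - \<epsilon>) / 2) \<le> sqrt (1 + n)"
  proof -
    have "n powr ((1 - \<epsilon>) / 2) \<le> (1 + n) powr ((1 - \<epsilon>) / 2)"
      using assms by (intro powr_mono2) auto
    also have "\<dots> \<le> (1 + n) powr (1 / 2)"
      using assms by (intro powr_mono) auto
    finally show ?thesis
      using assms by (simp add: powr_half_sqrt)
  qed
  ultimately have "?q \<le> 1 * sqrt (1 + n)"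
    by (intro mult_mono) auto
  moreover have "1 \<le> sqrt (1 + n)"
    using assms by simp
  ultimately have "1 + ?q \<le> 2 * sqrt (1 + n)"
    by linarith
  then have "B * (1 + ?q) \<le> B * (2 * sqrt (1 + n))"
    using assms by (intro mult_left_mono) auto
  then show "d \<le> 2 * B * sqrt (1 + n)"
    using jump by simp
  have q2: "?q\<^sup>2 = sqrt (1 - \<alpha>) * n powr (1 - \<epsilon>)"
  proof -
    have "((1 - \<alpha>) powr (1/4))\<^sup>2 = sqrt (1 - \<alpha>)"
      using assms by (simp add: power2_eq_square powr_half_sqrt flip: powr_add)
    moreover have "(n powr ((1 - \<epsilon>) / 2))\<^sup>2 = n powr (1 - \<epsilon>)"
      by (simp add: power2_eq_square flip: powr_add)
    ultimately show ?thesis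
      by (simp add: power_mult_distrib)
  qed
  have "d\<^sup>2 \<le> (B * (1 + ?q))\<^sup>2"
    using jump assms by (intro power_mono) auto
  also have "\<dots> = B\<^sup>2 * (1 + ?q)\<^sup>2"
    by (rule power_mult_distrib)
  also have "\<dots> \<le> B\<^sup>2 * (2 * (1 + ?q\<^sup>2))"
  proof (intro mult_left_mono)
    have "0 \<le> (1 - ?q)\<^sup>2"
      by simp
    then show "(1 + ?q)\<^sup>2 \<le> 2 * (1 + ?q\<^sup>2)"
      by (simp only: power2_sum power2_diff) simp
  qed auto
  finally show "d\<^sup>2 \<le> 2 * B\<^sup>2 * (1 + n powr (1 - \<epsilon>) / (1 / sqrt (1 - \<alpha>)))"
    unfolding q2 by (simp add: algebra_simps)
qed

lemma small_drift_chainI: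
  assumes "0 < \<alpha>" "\<alpha> < 1" "0 < \<epsilon>" "\<epsilon> < 1" "0 < \<Gamma>" "0 \<le> B"
    and jump: "\<And>y z. z \<in> set_pmf (K y) \<Longrightarrow> norm (lat z - lat y) \<le>
      B * (1 + (1 - \<alpha>) powr (1/4) * norm (lat y) powr ((1 - \<epsilon>) / 2))"
    and drift: "\<And>y. norm (measure_pmf.expectation (K y) (\<lambda>z. lat z - lat y)) \<le>
      \<Gamma> / (1 / sqrt (1 - \<alpha>))"
  shows "small_drift_chain K \<alpha> (2 * B) (1 / sqrt (1 - \<alpha>)) \<Gamma>"
proof (unfold_locales)
  show "1 \<le> 1 / sqrt (1 - \<alpha>)" "1 - \<alpha> = 1 / (1 / sqrt (1 - \<alpha>))\<^sup>2"
    using assms by (simp_all add: power_divide)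
  show "norm (lat z - lat y) \<le> 2 * B * sqrt (1 + norm (lat y))" if "z \<in> set_pmf (K y)" for z y
    using assms by (intro jump_sqrt_bound(1)[OF _ _ _ _ _ jump[OF that]]) auto
qed (use assms in auto)

lemma (in small_drift_chain) weighted_value_eq':
  assumes "poly_growth c" "\<And>y. 0 \<le> c y" "0 \<le> \<epsilon>"
  shows "weighted_value K \<alpha> c \<epsilon> x = dsum (\<lambda>y. c y / (1 + norm (lat y)) powr \<epsilon>)"
    and "weighted_value K \<alpha> c 1 x = dsum (\<lambda>y. c y / (1 + norm (lat y)))"
    and "0 \<le> weighted_value K \<alpha> c \<epsilon> x"
proof -
  show *: "weighted_value K \<alpha> c \<epsilon> x = dsum (\<lambda>y. c y / (1 + norm (lat y)) powr \<epsilon>)"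
    using weighted_value_eq[OF assms(1,3)] assms(2) by simp
  show "weighted_value K \<alpha> c 1 x = dsum (\<lambda>y. c y / (1 + norm (lat y)))"
    using weighted_value_eq[OF assms(1), of 1] assms(2) by (simp add: add_nonneg_nonneg)
  show "0 \<le> weighted_value K \<alpha> c \<epsilon> x"
    unfolding * using poly_growth_weighted[OF assms(1,3)] assms(2) by (intro dsum_nonneg) auto
qed

text \<open>Joins the cases \<open>k = 1\<close> and \<open>k \<ge> 2\<close> under one constant,
  fixed before the discount factor, the chain, the cost and the state.\<close>

lemma discounted_value_initial:
  fixes \<epsilon> \<Gamma> B :: real and k :: nat
  assumes \<epsilon>: "0 < \<epsilon>" "\<epsilon> < 1" and \<Gamma>: "0 < \<Gamma>" and B: "0 \<le> B" and k: "1 \<le> k"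
  obtains C where "0 \<le> C"
    and "\<And>\<alpha> (K :: int ^ 'd \<Rightarrow> (int ^ 'd) pmf) c x s. \<lbrakk>0 < \<alpha>; \<alpha> < 1; s = 1 / sqrt (1 - \<alpha>);
      cost_bounds k \<Gamma> c;
      \<And>y z. z \<in> set_pmf (K y) \<Longrightarrow> norm (lat z - lat y) \<le>
        B * (1 + (1 - \<alpha>) powr (1/4) * norm (lat y) powr ((1 - \<epsilon>) / 2));
      \<And>y. norm (measure_pmf.expectation (K y) (\<lambda>z. lat z - lat y)) \<le> \<Gamma> / s\<rbrakk> \<Longrightarrow>
      \<bar>discounted_value K \<alpha> c x - s\<^sup>2 * c x\<bar> \<le>
        C * (s ^ (k + 2) + s * (weighted_value K \<alpha> c 1 x + weighted_value K \<alpha> c \<epsilon> x))"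
proof -
  define \<beta> where "\<beta> = 2 * B\<^sup>2"
  \<comment> \<open>The power of \<open>1 + 2 * B\<close> comes from
    \<open>smooth_cost_second_order\<close> with \<open>A = 2 * B\<close>. For \<open>k = 1\<close>
    truncated subtraction makes it 1, and \<open>L\<close> is the Lipschitz constant
    \<open>2 * \<Gamma>\<close>.\<close>
  define L where "L = 2 * \<Gamma> * (1 + 2 * B) ^ (k - 2)"
  \<comment> \<open>\<open>a\<close> and \<open>b\<close> dominate the coefficients of both
    cases.\<close>
  define a where "a = L * (1 + \<Gamma> + 4 * \<Gamma>\<^sup>2 + 3 * \<beta>)"
  define b where "b = L * (\<Gamma> + 2 * \<beta>) * 2 ^ k * \<Gamma> + 4 * L * \<beta> * \<Gamma>"
  have \<beta>: "0 \<le> \<beta>"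
    by (simp add: \<beta>_def)
  have L: "2 * \<Gamma> \<le> L" "0 \<le> L"
  proof -
    have "1 \<le> (1 + 2 * B) ^ (k - 2)"
      using B by (intro one_le_power) auto
    then show "2 * \<Gamma> \<le> L"
      using \<Gamma> by (simp add: L_def)
    then show "0 \<le> L"
      using \<Gamma> by linarith
  qed
  have ab: "0 \<le> a" "0 \<le> b"
    using L(2) \<Gamma> \<beta> by (auto simp: a_def b_def intro!: add_nonneg_nonneg mult_nonneg_nonneg)
  show thesis
  proof (rule that[of "a + b"])
    show "0 \<le> a + b"
      using ab by simp
    fix \<alpha> s :: real and K :: "int ^ 'd \<Rightarrow> (int ^ 'd) pmf" and c :: "int ^ 'd \<Rightarrow> real" and x :: "int ^ 'd"
    assume \<alpha>: "0 < \<alpha>" "\<alpha> < 1" and s_eq: "s = 1 / sqrt (1 - \<alpha>)" and c: "cost_bounds k \<Gamma> c"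
      and jmp: "\<And>y z. z \<in> set_pmf (K y) \<Longrightarrow> norm (lat z - lat y) \<le>
        B * (1 + (1 - \<alpha>) powr (1/4) * norm (lat y) powr ((1 - \<epsilon>) / 2))"
      and drft: "\<And>y. norm (measure_pmf.expectation (K y) (\<lambda>z. lat z - lat y)) \<le> \<Gamma> / s"
    interpret small_drift_chain K \<alpha> "2 * B" x s \<Gamma>
      unfolding s_eq by (rule small_drift_chainI[OF \<alpha> \<epsilon> \<Gamma> B jmp drft[unfolded s_eq]])
    note c' = cost_boundsD[OF c \<Gamma>]
    have c0: "\<And>y. 0 \<le> c y"
      by (rule c'(2))
    note W = weighted_value_eq'[OF c'(1) c0]
    let ?W1 = "weighted_value K \<alpha> c 1 x" and ?We = "weighted_value K \<alpha> c \<epsilon> x"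
    have W0: "0 \<le> ?W1" "0 \<le> ?We"
      using W(3)[of 1] W(3)[of \<epsilon>] \<epsilon> by auto
    have jump2: "(norm (lat z - lat y))\<^sup>2 \<le> \<beta> * (1 + norm (lat y) powr (1 - \<epsilon>) / s)"
      if "z \<in> set_pmf (K y)" for y z
      unfolding \<beta>_def s_eq using \<alpha> \<epsilon> B by (intro jump_sqrt_bound(2)[OF _ _ _ _ _ jmp[OF that]]) auto
    obtain f where f: "\<And>y. f (lat y) = c y" "smooth_cost k \<Gamma> f"
      using c unfolding cost_bounds_def by blast
    have "\<bar>dsum c - s\<^sup>2 * c x\<bar> \<le> a * s ^ (k + 2) + b * (s * (?W1 + ?We))"
    proof (cases "k = 1")
      case True
      have "\<bar>c y - c x\<bar> \<le> L * norm (lat y - lat x)" for y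
      proof -
        have "\<bar>f (lat y) - f (lat x)\<bar> \<le> 2 * \<Gamma> * norm (lat y - lat x)"
          using f(2) unfolding True by (rule smooth_cost_Lipschitz)
        also have "\<dots> \<le> L * norm (lat y - lat x)"
          using L by (intro mult_right_mono) auto
        finally show ?thesis
          by (simp add: f(1))
      qed
      then have "\<bar>dsum c - s\<^sup>2 * c x\<bar> \<le> L * (1 + 4 * \<Gamma>\<^sup>2 + 2 * \<beta>) * s ^ 3 + 4 * L * \<beta> * \<Gamma> * ?We"
        unfolding W(1)[OF less_imp_le[OF \<epsilon>(1)]] using c'(3)[unfolded True]
        by (intro dsum_Lipschitz \<epsilon> \<beta> L jump2 c'(1,2)) auto
      also have "\<dots> \<le> a * s ^ (k + 2) + b * (s * (?W1 + ?We))"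
      proof (rule add_mono)
        show "L * (1 + 4 * \<Gamma>\<^sup>2 + 2 * \<beta>) * s ^ 3 \<le> a * s ^ (k + 2)"
          unfolding True a_def using L \<Gamma> \<beta> s(1)
          by (simp add: numeral_3_eq_3)
        have "1 * ?We \<le> s * (?W1 + ?We)"
          using W0 s(1) by (intro mult_mono) auto
        moreover have "4 * L * \<beta> * \<Gamma> \<le> b"
          using L \<Gamma> \<beta> by (simp add: b_def)
        ultimately show "4 * L * \<beta> * \<Gamma> * ?We \<le> b * (s * (?W1 + ?We))"
          using W0 ab by (intro mult_mono) auto
      qed
      finally show ?thesis .
    next
      case False
      then have k2: "2 \<le> k"
        using k by simp
      obtain g where g: "\<And>y. norm (g y) \<le> 2 * \<Gamma> * (1 + norm y) ^ (k - 1)"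
        "\<And>y z A. 0 \<le> A \<Longrightarrow> norm (z - y) \<le> A * (1 + norm y) \<Longrightarrow>
          \<bar>f z - f y - g y \<bullet> (z - y)\<bar> \<le>
            2 * \<Gamma> * (1 + A) ^ (k - 2) * (1 + norm y) ^ (k - 2) * (norm (z - y))\<^sup>2"
        using smooth_cost_second_order[OF f(2) k2 \<Gamma>] by blast
      have "\<bar>dsum c - s\<^sup>2 * c x\<bar> \<le> L * (\<Gamma> + 3 * \<beta>) * s ^ (k + 2) +
          L * (\<Gamma> + 2 * \<beta>) * 2 ^ k * \<Gamma> * s * ?W1"
        unfolding W(2)[OF zero_le_one]
      proof (rule dsum_second_order[where g = "\<lambda>y. g (lat y)", OF \<epsilon> \<beta> L(2) k2 jump2 c'])
        show "norm (g (lat y)) \<le> L * (1 + norm (lat y)) ^ (k - 1)" for y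
          using g(1)[of "lat y"] mult_right_mono[OF L(1), of "(1 + norm (lat y)) ^ (k - 1)"]
          by (simp add: order_trans)
        show "\<bar>c z - c y - g (lat y) \<bullet> (lat z - lat y)\<bar> \<le>
            L * (1 + norm (lat y)) ^ (k - 2) * (norm (lat z - lat y))\<^sup>2"
          if "z \<in> set_pmf (K y)" for y z
        proof -
          have "sqrt (1 + norm (lat y)) \<le> 1 + norm (lat y)"
            by (intro real_le_lsqrt self_le_power) auto
          then have "2 * B * sqrt (1 + norm (lat y)) \<le> 2 * B * (1 + norm (lat y))"
            using B by (intro mult_left_mono) auto
          then have "norm (lat z - lat y) \<le> 2 * B * (1 + norm (lat y))"
            using jump[OF that]
            by linarith
          then show ?thesis
            using g(2)[of "2 * B" "lat z" "lat y"] B by (simp add: L_def f(1))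
        qed
      qed
      also have "\<dots> \<le> a * s ^ (k + 2) + b * (s * (?W1 + ?We))"
      proof (rule add_mono)
        show "L * (\<Gamma> + 3 * \<beta>) * s ^ (k + 2) \<le> a * s ^ (k + 2)"
          unfolding a_def using L \<Gamma> \<beta> s(1)
          by (intro mult_right_mono mult_left_mono) auto
        have "s * ?W1 \<le> s * (?W1 + ?We)"
          using W0 s(1) by (intro mult_left_mono) auto
        moreover have "L * (\<Gamma> + 2 * \<beta>) * 2 ^ k * \<Gamma> \<le> b"
          using L \<Gamma> \<beta> by (simp add: b_def)
        ultimately have "L * (\<Gamma> + 2 * \<beta>) * 2 ^ k * \<Gamma> * (s * ?W1) \<le> b * (s * (?W1 + ?We))"
          using W0 ab s(1)
          by (intro mult_mono) auto
        then show "L * (\<Gamma> + 2 * \<beta>) * 2 ^ k * \<Gamma> * s * ?W1 \<le> b * (s * (?W1 + ?We))"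
          by (simp only: mult.assoc)
      qed
      finally show ?thesis .
    qed
    also have "\<dots> \<le> (a + b) * (s ^ (k + 2) + s * (?W1 + ?We))"
      using ab W0 s(1)
      by (simp add: algebra_simps add_nonneg_nonneg)
    finally show "\<bar>discounted_value K \<alpha> c x - s\<^sup>2 * c x\<bar> \<le> (a + b) * (s ^ (k + 2) + s * (?W1 + ?We))"
      by (simp only: discounted_value_eq[OF c'(1)])
  qed
qed

text \<open>For bounded \<open>s\<close> the initial term suffices; for large \<open>s\<close> the
  distant start serves \<open>k \<le> 2\<close> and ellipticity serves \<open>k \<ge> 3\<close>. The
  threshold \<open>2 + 8 * H\<close> ensures \<open>8 * H \<le> s\<^sup>2\<close> and
  \<open>\<alpha> \<ge> 1 / 2\<close>.\<close>

lemma weighted_value_ge: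
  fixes \<epsilon> \<kappa> lam \<Gamma> J :: real and k :: nat
  assumes \<epsilon>: "0 < \<epsilon>" "\<epsilon> < 1" and \<Gamma>: "0 < \<Gamma>" and lam: "0 < lam" and J: "0 \<le> J" and k: "1 \<le> k"
    and \<kappa>: "\<kappa> \<ge> 2 + \<epsilon> - real k / 2"
  obtains C where "0 \<le> C"
    and "\<And>\<alpha> (P :: int ^ 'd \<Rightarrow> (int ^ 'd) pmf) c x s. \<lbrakk>0 < \<alpha>; \<alpha> < 1; s = 1 / sqrt (1 - \<alpha>);
      primitives_assumption k \<Gamma> lam \<alpha> P c;
      \<And>y z. z \<in> set_pmf (P y) \<Longrightarrow> norm (lat z - lat y) \<le> J;
      norm (lat x) \<ge> (1 - \<alpha>) powr (- (1 + \<kappa>))\<rbrakk> \<Longrightarrow>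
      s ^ (k + 1) \<le> C * weighted_value P \<alpha> c 1 x"
proof -
  \<comment> \<open>The constant produced by \<open>dsum_displacement\<close> for squared jumps of
    at most \<open>J\<^sup>2\<close>.\<close>
  define H where "H = 4 * \<Gamma>\<^sup>2 + 2 * J\<^sup>2"
  define \<delta> where "\<delta> = sqrt (lam / (8 * (1 + 2 * \<Gamma>\<^sup>2 / lam)))"
  define C1 where "C1 = 2 * \<Gamma> * (2 + 8 * H) ^ (k + 1)"
  define C2 where "C2 = 2 ^ (k + 1) * \<Gamma>"
  define C3 where "C3 = 2 * \<Gamma> / \<delta> ^ (k - 1)"
  have \<delta>: "0 < \<delta>"
    unfolding \<delta>_def using lam by (simp add: add_pos_nonneg)
  have H: "0 \<le> H"
    by (simp add: H_def)
  have C: "0 \<le> C1" "0 \<le> C2" "0 \<le> C3"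
    using \<Gamma> H \<delta> by (auto simp: C1_def C2_def C3_def)
  show thesis
  proof (rule that[of "C1 + C2 + C3"])
    show "0 \<le> C1 + C2 + C3"
      using C by simp
    fix \<alpha> s :: real and P :: "int ^ 'd \<Rightarrow> (int ^ 'd) pmf" and c :: "int ^ 'd \<Rightarrow> real" and x :: "int ^ 'd"
    assume \<alpha>: "0 < \<alpha>" "\<alpha> < 1" and s_eq: "s = 1 / sqrt (1 - \<alpha>)"
      and prim: "primitives_assumption k \<Gamma> lam \<alpha> P c"
      and jmp: "\<And>y z. z \<in> set_pmf (P y) \<Longrightarrow> norm (lat z - lat y) \<le> J"
      and x: "norm (lat x) \<ge> (1 - \<alpha>) powr (- (1 + \<kappa>))"
    have jump': "norm (lat z - lat y) \<le> J * (1 + (1 - \<alpha>) powr (1/4) * norm (lat y) powr ((1 - \<epsilon>) / 2))"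
      if "z \<in> set_pmf (P y)" for y z
      using jmp[OF that] J by (simp add: distrib_left add_increasing2)
    interpret small_drift_chain P \<alpha> "2 * J" x s \<Gamma>
      unfolding s_eq by (rule small_drift_chainI[OF \<alpha> \<epsilon> \<Gamma> J jump' primitives_assumptionD(2)[OF prim \<alpha>(2)]])
    have s1: "1 \<le> s" and s2: "1 - \<alpha> = 1 / s\<^sup>2"
      using s by auto
    note c = cost_boundsD[OF primitives_assumptionD(1)[OF prim \<alpha>(2)] \<Gamma>]
    have c0: "\<And>y. 0 \<le> c y"
      by (rule c(2))
    note W = weighted_value_eq'[OF c(1) c0 zero_le_one]
    let ?W = "weighted_value P \<alpha> c 1 x"
    have "0 < norm (lat x)"
      using x \<alpha> by (smt (verit) powr_gt_zero)
    then have "x \<noteq> 0"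
      by auto
    then have W1: "1 \<le> 2 * \<Gamma> * ?W"
      unfolding W(2) by (intro weighted_ge_initial[OF k c])
    have small: "s ^ (k + 1) \<le> C1 * ?W" if "s \<le> 2 + 8 * H"
    proof -
      have "s ^ (k + 1) \<le> (2 + 8 * H) ^ (k + 1) * 1"
        using that s1 by (simp add: power_mono del: power_Suc)
      also have "\<dots> \<le> (2 + 8 * H) ^ (k + 1) * (2 * \<Gamma> * ?W)"
        using W1 H by (intro mult_left_mono) auto
      finally show ?thesis
        by (simp add: C1_def mult_ac)
    qed
    have "s ^ (k + 1) \<le> C1 * ?W \<or> s ^ (k + 1) \<le> C2 * ?W \<or> s ^ (k + 1) \<le> C3 * ?W"
    proof (cases "s \<le> 2 + 8 * H")
      case True
      then show ?thesis
        using small by blast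
    next
      case s_large: False
      have ss: "s \<le> s\<^sup>2"
        using s1 by (simp add: self_le_power)
      show ?thesis
      proof (cases "k \<le> 2")
        case True
        \<comment> \<open>For \<open>k \<le> 2\<close> the hypothesis on \<open>\<kappa>\<close>
          gives \<open>1 + \<kappa> \<ge> 2\<close>, and \<open>(1 - \<alpha>) powr (- 2)\<close>
          equals \<open>s ^ 4\<close>.\<close>
        have "s ^ 4 \<le> norm (lat x)"
        proof -
          have "s ^ 4 = (1 - \<alpha>) powr (- 2)"
            using \<alpha> by (simp add: s2 powr_minus powr_divide power_divide inverse_eq_divide
                flip: power_mult)
          also have "\<dots> \<le> (1 - \<alpha>) powr (- (1 + \<kappa>))"
            using \<alpha> \<kappa> \<epsilon> True by (intro powr_mono') auto
          finally show ?thesis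
            using x by linarith
        qed
        moreover have "dsum (\<lambda>y. (norm (lat y - lat x))\<^sup>2) \<le> H * s ^ 4"
        proof -
          have "dsum (\<lambda>y. (norm (lat y - lat x))\<^sup>2) \<le>
              2 * s\<^sup>2 * (2 * \<Gamma>\<^sup>2 * s\<^sup>2 + dsum (\<lambda>_. J\<^sup>2))"
            by (intro dsum_displacement poly_growth_const power_mono[OF jmp]) auto
          also have "\<dots> = H * s ^ 4"
            by (simp add: dsum_const' H_def algebra_simps flip: power_add)
          finally show ?thesis .
        qed
        moreover have "8 * H \<le> s\<^sup>2"
          using s_large ss by linarith
        ultimately show ?thesis
          unfolding C2_def W(2) using weighted_ge_far[OF k c _ _ H] by blast
      next
        case False
        then obtain j where j: "k = j + 3"
          by (metis add.commute le_Suc_ex not_less_eq_eq numeral_2_eq_2 numeral_3_eq_3)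
        have "1 / 2 \<le> \<alpha>"
        proof -
          have "2 \<le> s\<^sup>2"
            using s_large ss H by linarith
          then have "1 / s\<^sup>2 \<le> 1 / 2"
            by (intro divide_left_mono) auto
          then show ?thesis
            using s2 by linarith
        qed
        then have "\<delta> ^ (j + 2) * s ^ (j + 4) \<le> 2 * \<Gamma> * ?W"
          unfolding W(2)
          by (intro weighted_ge_elliptic[OF lam _ _ c(1,2) c(3)[unfolded j] \<delta>_def]
              primitives_assumptionD(3)[OF prim \<alpha>(2) finite_step])
        then have "s ^ (k + 1) \<le> C3 * ?W"
          using \<delta> unfolding C3_def j by (simp add: field_simps)
        then show ?thesis
          by blast
      qed
    qed
    moreover have "0 \<le> C1 * ?W" "0 \<le> C2 * ?W" "0 \<le> C3 * ?W"
      using C W(3) by auto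
    ultimately show "s ^ (k + 1) \<le> (C1 + C2 + C3) * ?W"
      by (auto simp: distrib_right)
  qed
qed

text \<open>The constant precedes the quantifiers over the discount factor, the chains, the cost and
  the state, which expresses its uniformity; \<open>J\<close> and \<open>B\<close> are the constants
  of the two jump hypotheses.\<close>

theorem theorem4:
  fixes \<epsilon> \<kappa> lam \<Gamma> J B :: real and k :: nat
  assumes "0 < \<epsilon>" and "\<epsilon> < 1"
    and "1 \<le> k"
    and "\<kappa> \<ge> 2 + \<epsilon> - real k / 2"
    and "0 < lam" and "0 < \<Gamma>"
  shows "\<exists>C::real. \<forall>(\<alpha>::real) (P :: int ^ 'd \<Rightarrow> (int ^ 'd) pmf) (c :: int ^ 'd \<Rightarrow> real)
      (M :: 'm set) (rep :: 'm \<Rightarrow> int ^ 'd) (G :: int ^ 'd \<Rightarrow> 'm pmf).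
      0 < \<alpha> \<and> \<alpha> < 1 \<and>
      (\<forall>x. max_jump P x \<le> ereal J) \<and>
      primitives_assumption k \<Gamma> lam \<alpha> P c \<and>
      zero_mean_construction M rep G \<and>
      (\<forall>x. max_jump (sister_chain P G rep) x
             \<le> ereal (B * (1 + (1 - \<alpha>) powr (1/4) * norm (lat x) powr ((1 - \<epsilon>) / 2))))
      \<longrightarrow>
      (\<forall>x. norm (lat x) \<ge> (1 - \<alpha>) powr (- (1 + \<kappa>)) \<longrightarrow>
         \<bar>discounted_value (sister_chain P G rep) \<alpha> c x - discounted_value P \<alpha> c x\<bar>
           \<le> C * (1 / sqrt (1 - \<alpha>) *
               (weighted_value P \<alpha> c 1 x + weighted_value (sister_chain P G rep) \<alpha> c 1 x
                + weighted_value P \<alpha> c \<epsilon> x + weighted_value (sister_chain P G rep) \<alpha> c \<epsilon> x)))"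
proof -
  \<comment> \<open>Nonnegative replacements for \<open>J\<close> and \<open>B\<close>. As
    \<open>B'\<close> is also at least \<open>J'\<close>, both chains satisfy the jump bound of
    \<open>small_drift_chainI\<close> with \<open>B'\<close>.\<close>
  define J' where "J' = max J 0"
  define B' where "B' = max B J'"
  have JB: "0 \<le> J'" "J \<le> J'" "0 \<le> B'" "B \<le> B'" "J' \<le> B'"
    by (auto simp: J'_def B'_def)
  obtain C1 where C1: "0 \<le> C1"
    and initial: "\<And>\<alpha> (K :: int ^ 'd \<Rightarrow> (int ^ 'd) pmf) c x s. \<lbrakk>0 < \<alpha>; \<alpha> < 1; s = 1 / sqrt (1 - \<alpha>);
      cost_bounds k \<Gamma> c;
      \<And>y z. z \<in> set_pmf (K y) \<Longrightarrow> norm (lat z - lat y) \<le>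
        B' * (1 + (1 - \<alpha>) powr (1/4) * norm (lat y) powr ((1 - \<epsilon>) / 2));
      \<And>y. norm (measure_pmf.expectation (K y) (\<lambda>z. lat z - lat y)) \<le> \<Gamma> / s\<rbrakk> \<Longrightarrow>
      \<bar>discounted_value K \<alpha> c x - s\<^sup>2 * c x\<bar> \<le>
        C1 * (s ^ (k + 2) + s * (weighted_value K \<alpha> c 1 x + weighted_value K \<alpha> c \<epsilon> x))"
    using discounted_value_initial[OF assms(1,2,6) JB(3) assms(3)] by blast
  obtain C2 where C2: "0 \<le> C2"
    and lower: "\<And>\<alpha> (P :: int ^ 'd \<Rightarrow> (int ^ 'd) pmf) c x s. \<lbrakk>0 < \<alpha>; \<alpha> < 1; s = 1 / sqrt (1 - \<alpha>);
      primitives_assumption k \<Gamma> lam \<alpha> P c;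
      \<And>y z. z \<in> set_pmf (P y) \<Longrightarrow> norm (lat z - lat y) \<le> J';
      norm (lat x) \<ge> (1 - \<alpha>) powr (- (1 + \<kappa>))\<rbrakk> \<Longrightarrow>
      s ^ (k + 1) \<le> C2 * weighted_value P \<alpha> c 1 x"
    using weighted_value_ge[OF assms(1,2,6,5) JB(1) assms(3,4)] by blast
  show ?thesis
  proof (intro exI[of _ "C1 * (2 * C2 + 1)"] allI impI, elim conjE)
    fix \<alpha> :: real and P :: "int ^ 'd \<Rightarrow> (int ^ 'd) pmf" and c :: "int ^ 'd \<Rightarrow> real"
      and M :: "'m set" and rep :: "'m \<Rightarrow> int ^ 'd" and G :: "int ^ 'd \<Rightarrow> 'm pmf" and x :: "int ^ 'd"
    assume \<alpha>: "0 < \<alpha>" "\<alpha> < 1"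
      and jumpP: "\<forall>x. max_jump P x \<le> ereal J"
      and prim: "primitives_assumption k \<Gamma> lam \<alpha> P c"
      and zm: "zero_mean_construction M rep G"
      and jumpS: "\<forall>x. max_jump (sister_chain P G rep) x
        \<le> ereal (B * (1 + (1 - \<alpha>) powr (1/4) * norm (lat x) powr ((1 - \<epsilon>) / 2)))"
      and x: "norm (lat x) \<ge> (1 - \<alpha>) powr (- (1 + \<kappa>))"
    let ?S = "sister_chain P G rep"
    let ?g = "\<lambda>y. 1 + (1 - \<alpha>) powr (1/4) * norm (lat y) powr ((1 - \<epsilon>) / 2)"
    define s where "s = 1 / sqrt (1 - \<alpha>)"
    have g: "1 \<le> ?g y" for y :: "int ^ 'd"
      by simp
    have jP: "norm (lat z - lat y) \<le> J'" if "z \<in> set_pmf (P y)" for y z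
      using jumpP that JB(2) by (force simp: max_jump_le_iff)
    have jP': "norm (lat z - lat y) \<le> B' * ?g y" if "z \<in> set_pmf (P y)" for y z
      using jP[OF that] JB(5) mult_left_mono[OF g[of y] JB(3)] by simp
    have jS: "norm (lat z - lat y) \<le> B' * ?g y" if "z \<in> set_pmf (?S y)" for y z
    proof -
      have "norm (lat z - lat y) \<le> B * ?g y"
        using jumpS that unfolding max_jump_le_iff by blast
      also have "\<dots> \<le> B' * ?g y"
        using g[of y] by (intro mult_right_mono JB(4)) linarith
      finally show ?thesis .
    qed
    note dP = primitives_assumptionD(2)[OF prim \<alpha>(2)]
    interpret P: small_drift_chain P \<alpha> "2 * B'" x s \<Gamma>
      unfolding s_def by (rule small_drift_chainI[OF \<alpha> assms(1,2,6) JB(3) jP' dP])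
    \<comment> \<open>Finiteness is taken directly from the jump bound, because
      \<open>sister_chain_mean\<close> uses it to provide the drift bound for the interpretation
      \<open>S\<close>.\<close>
    have finS: "finite (set_pmf (?S y))" for y
    proof (rule finite_subset[OF _ finite_lat_ball])
      show "set_pmf (?S y) \<subseteq> {z. norm (lat z) \<le> norm (lat y) + B' * ?g y}"
      proof
        fix z assume "z \<in> set_pmf (?S y)"
        then show "z \<in> {z. norm (lat z) \<le> norm (lat y) + B' * ?g y}"
          using jS[of z y] norm_triangle_sub[of "lat z" "lat y"] by simp
      qed
    qed
    have dS: "norm (measure_pmf.expectation (?S y) (\<lambda>z. lat z - lat y)) \<le> \<Gamma> / (1 / sqrt (1 - \<alpha>))" for y
      unfolding sister_chain_mean[OF zm finS P.finite_step] by (rule dP)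
    interpret S: small_drift_chain ?S \<alpha> "2 * B'" x s \<Gamma>
      unfolding s_def by (rule small_drift_chainI[OF \<alpha> assms(1,2,6) JB(3) jS dS])
    note cost = primitives_assumptionD(1)[OF prim \<alpha>(2)]
    note c = cost_boundsD[OF cost assms(6)]
    let ?WP = "weighted_value P \<alpha> c 1 x" and ?WPe = "weighted_value P \<alpha> c \<epsilon> x"
      and ?WS = "weighted_value ?S \<alpha> c 1 x" and ?WSe = "weighted_value ?S \<alpha> c \<epsilon> x"
    have W0: "0 \<le> ?WP" "0 \<le> ?WPe" "0 \<le> ?WS" "0 \<le> ?WSe"
      using assms(1) by (auto intro: P.weighted_value_eq'(3) S.weighted_value_eq'(3) c)
    let ?W = "?WP + ?WS + ?WPe + ?WSe"
    have s1: "1 \<le> s"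
      by (rule P.s(1))
    have "\<bar>discounted_value P \<alpha> c x - s\<^sup>2 * c x\<bar> \<le> C1 * (s ^ (k + 2) + s * (?WP + ?WPe))"
      by (intro initial \<alpha> s_def cost jP' dP[folded s_def])
    moreover have "\<bar>discounted_value ?S \<alpha> c x - s\<^sup>2 * c x\<bar> \<le> C1 * (s ^ (k + 2) + s * (?WS + ?WSe))"
      by (intro initial \<alpha> s_def cost jS dS[folded s_def])
    \<comment> \<open>Both values are compared with the same frozen value, which cancels.\<close>
    ultimately have "\<bar>discounted_value ?S \<alpha> c x - discounted_value P \<alpha> c x\<bar> \<le>
        C1 * (s ^ (k + 2) + s * (?WP + ?WPe)) + C1 * (s ^ (k + 2) + s * (?WS + ?WSe))"
      by linarith
    also have "\<dots> = C1 * (2 * (s * s ^ (k + 1)) + s * ?W)"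
      by (simp add: algebra_simps)
    also have "\<dots> \<le> C1 * (2 * (s * (C2 * ?W)) + s * ?W)"
    proof -
      \<comment> \<open>The excess power of \<open>s\<close> from both chains is charged to the
        focal chain, whose ellipticity and bounded jumps yield the lower bound.\<close>
      have "s ^ (k + 1) \<le> C2 * ?WP"
        by (rule lower[OF \<alpha> s_def prim jP x])
      also have "\<dots> \<le> C2 * ?W"
        using C2 W0 by (intro mult_left_mono) auto
      finally show ?thesis
        using C1 s1 by (intro mult_left_mono add_right_mono) auto
    qed
    also have "\<dots> = C1 * (2 * C2 + 1) * (1 / sqrt (1 - \<alpha>) * ?W)"
      by (simp add: algebra_simps flip: s_def)
    finally show "\<bar>discounted_value ?S \<alpha> c x - discounted_value P \<alpha> c x\<bar> \<le>
        C1 * (2 * C2 + 1) * (1 / sqrt (1 - \<alpha>) * ?W)" .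
  qed
qed

end
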